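(* Let $q\ge5$ be an odd prime power, $m=2t+1\ge5$, and $n=\frac{q^m+1}{q+1}$. For an integer $\delta$ put $\epsilon=\lceil(\delta-1)(1-q^{-1})\rceil$, and let $A=\frac{q^{t+1}+2q^t+1}{q+1}$, $B=2\frac{q^{t+1}-1}{q+1}-1$ if $t$ is odd, and $A=\frac{q^{t+1}+2q^t-1}{q+1}$, $B=2\frac{q^{t+1}+1}{q+1}-1$ if $t$ is even. Then the LCD BCH code $\mathcal{C}_{(n,q,\delta,1)}$ has parameters $[n,k,d\ge\delta]$ and $\mathcal{C}_{(n,q,\delta+1,0)}$ has parameters $[n,k-1,d\ge2\delta]$, where $k=n-2m(\epsilon-1)$ if $q^t+2\le\delta\le A$, and $k=n-2m(\epsilon-2)$ if $A+1\le\delta\le B$.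
   Context: Let $q$ be a prime power and $n\ge2$ an integer with $\gcd(n,q)=1$. Let $\ell=\mathrm{ord}_n(q)$, let $\alpha$ be a generator of $\mathbb{F}_{q^\ell}^*$, $\beta=\alpha^{(q^\ell-1)/n}$, and let $m_i(x)$ be the minimal polynomial of $\beta^i$ over $\mathbb{F}_q$. For integers $b\ge0$ and $2\le\delta\le n$, $\mathcal{C}_{(n,q,\delta,b)}$ denotes the cyclic (BCH) code of length $n$ over $\mathbb{F}_q$ with generator polynomial $\mathrm{lcm}(m_b(x),\dots,m_{b+\delta-2}(x))$. A linear code $\mathcal{C}$ is LCD if $\mathcal{C}\cap\mathcal{C}^\perp=\{0\}$ (Euclidean dual). $[n,k,d\ge D]$ means length $n$, dimension $k$, minimum Hamming distance at least $D$. *)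

theory Defs
  imports "HOL-Computational_Algebra.Computational_Algebra" "HOL-Number_Theory.Pocklington"
begin

definition minimal_poly :: "('a::field \<Rightarrow> 'b::field) \<Rightarrow> 'b \<Rightarrow> 'a poly" where
  "minimal_poly emb x = (SOME p. p \<noteq> 0 \<and> lead_coeff p = 1 \<and> poly (map_poly emb p) x = 0 \<and>
      (\<forall>r. r \<noteq> 0 \<and> poly (map_poly emb r) x = 0 \<longrightarrow> degree p \<le> degree r))"

text \<open>Generator polynomial lcm(m_b, ..., m_{b+delta-2}) of the BCH code:
  the monic polynomial whose multiples are exactly the common multiples.\<close>
definition bch_generator :: "('a::field \<Rightarrow> 'b::field) \<Rightarrow> 'b \<Rightarrow> nat \<Rightarrow> nat \<Rightarrow> 'a poly" where
  "bch_generator emb \<beta> \<delta> b = (SOME g. lead_coeff g = 1 \<and>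
      (\<forall>p. g dvd p \<longleftrightarrow> (\<forall>i\<in>{b..b + \<delta> - 2}. minimal_poly emb (\<beta> ^ i) dvd p)))"

text \<open>The cyclic code of length n generated by g, with codewords represented by
  polynomials of degree < n (representatives in F_q[x]/(x^n-1)).\<close>
definition cyclic_code :: "nat \<Rightarrow> 'a::field poly \<Rightarrow> 'a poly set" where
  "cyclic_code n g = {c. degree c < n \<and> g dvd c}"

definition bch_code :: "nat \<Rightarrow> ('a::field \<Rightarrow> 'b::field) \<Rightarrow> 'b \<Rightarrow> nat \<Rightarrow> nat \<Rightarrow> 'a poly set" where
  "bch_code n emb \<beta> \<delta> b = cyclic_code n (bch_generator emb \<beta> \<delta> b)"

definition hamming_weight :: "'a::zero poly \<Rightarrow> nat" where
  "hamming_weight c = card {i. Polynomial.coeff c i \<noteq> 0}"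

definition dual_code :: "nat \<Rightarrow> 'a::field poly set \<Rightarrow> 'a poly set" where
  "dual_code n C = {v. degree v < n \<and> (\<forall>c\<in>C. (\<Sum>i<n. Polynomial.coeff c i * Polynomial.coeff v i) = 0)}"

definition is_LCD :: "nat \<Rightarrow> 'a::field poly set \<Rightarrow> bool" where
  "is_LCD n C \<longleftrightarrow> C \<inter> dual_code n C = {0}"

end

theory Submission
  imports Defs
begin

text \<open>
  Put \<open>\<sigma> = 1\<close> for odd \<open>t\<close> and \<open>\<sigma> = -1\<close> for even \<open>t\<close>, \<open>Q = q ^ t\<close>, \<open>r = (Q + \<sigma>) / (q + 1)\<close> and
  \<open>a = Q - r\<close>. Then \<open>n = Q * a + \<sigma> * r\<close>, \<open>A = Q + r\<close>, \<open>B = 2 * a - 1\<close>, and \<open>q ^ m \<equiv> -1\<close> modulo \<open>n\<close>,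
  so every cyclotomic coset is closed under negation. This gives the LCD property, and together
  with the zero \<open>1\<close> it gives the \<open>2 * \<delta> - 1\<close> consecutive zeros behind the bound \<open>2 * \<delta>\<close>. If
  \<open>i, j \<le> 2 * a - 2\<close> are not divisible by \<open>q\<close> and lie in one coset, then
  \<open>i * q ^ s \<equiv> \<plusminus>j\<close> with \<open>s \<le> t\<close> after possibly swapping \<open>i\<close> and \<open>j\<close>; comparing sizes leaves besides
  \<open>i = j\<close> only the pairs \<open>(a, r)\<close> and \<open>(a - \<sigma>, A)\<close>. Hence the \<open>\<epsilon>\<close> numbers below \<open>\<delta>\<close> not divisible
  by \<open>q\<close>, with \<open>a\<close> and \<open>A\<close> removed, represent pairwise different cosets of full size \<open>2 * m\<close>.
\<close>

section \<open>Cyclic codes with prescribed zeros\<close>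

text \<open>Stated for an arbitrary map because it serves twice: for the embedding
  \<open>emb\<close> and for the Frobenius map \<open>x ^ q\<close>.\<close>

lemma map_poly_hom_mult:
  fixes f :: "'c::comm_ring_1 \<Rightarrow> 'd::comm_ring_1"
  assumes add: "\<And>x y. f (x + y) = f x + f y" and mult: "\<And>x y. f (x * y) = f x * f y"
    and zero: "f 0 = 0"
  shows "map_poly f (p * r) = map_poly f p * map_poly f r"
proof (rule poly_eqI)
  fix k
  have sum: "f (sum h S) = (\<Sum>x\<in>S. f (h x))" for h :: "nat \<Rightarrow> 'c" and S
    by (induction S rule: infinite_finite_induct) (auto simp: add zero)
  show "poly.coeff (map_poly f (p * r)) k = poly.coeff (map_poly f p * map_poly f r) k"
    by (simp add: coeff_map_poly zero coeff_mult sum mult)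
qed

lemma map_poly_hom_add:
  fixes f :: "'c::comm_ring_1 \<Rightarrow> 'd::comm_ring_1"
  assumes add: "\<And>x y. f (x + y) = f x + f y" and zero: "f 0 = 0"
  shows "map_poly f (p + r) = map_poly f p + map_poly f r"
  by (rule poly_eqI) (simp add: coeff_map_poly zero add)

lemma poly_map_poly_hom:
  fixes f :: "'c::comm_ring_1 \<Rightarrow> 'd::comm_ring_1"
  assumes add: "\<And>x y. f (x + y) = f x + f y" and mult: "\<And>x y. f (x * y) = f x * f y"
    and zero: "f 0 = 0"
  shows "poly (map_poly f p) (f x) = f (poly p x)"
  by (induction p) (auto simp: map_poly_pCons zero add mult)

text \<open>Multiplication by a nonzero \<open>x\<close> permutes the nonzero elements; comparing
  the product of all of them before and after leaves \<open>x ^ (card UNIV - 1) = 1\<close>.\<close>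

lemma finite_field_power_card:
  fixes x :: "'a :: {finite, field}"
  shows "x ^ card (UNIV :: 'a set) = x"
proof (cases "x = 0")
  case False
  have "(\<Prod>y\<in>UNIV-{0}. y) = (\<Prod>y\<in>UNIV-{0}. x * y)"
    by (rule prod.reindex_bij_witness[of _ "\<lambda>y. x * y" "\<lambda>y. y / x"]) (use False in auto)
  also have "\<dots> = x ^ (card (UNIV :: 'a set) - 1) * (\<Prod>y\<in>UNIV-{0}. y)"
    by (simp add: prod.distrib card_Diff_singleton)
  finally have "x ^ (card (UNIV :: 'a set) - 1) = 1"
    by simp
  moreover have "card (UNIV :: 'a set) = Suc (card (UNIV :: 'a set) - 1)"
    by (simp add: card_gt_0_iff)
  ultimately show ?thesis
    by (metis mult.right_neutral power_Suc)
qed (simp add: card_gt_0_iff)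

text \<open>Vanishing coefficients are used instead of a degree bound so that \<open>d = 0\<close>
  still leaves the zero polynomial. The induction splits off the constant coefficient.\<close>

lemma card_polys_coeff_bound:
  "card {h :: 'a::{finite,field} poly. \<forall>i\<ge>d. poly.coeff h i = 0} = card (UNIV :: 'a set) ^ d"
proof (induction d)
  case 0
  have "{h :: 'a poly. \<forall>i\<ge>0. poly.coeff h i = 0} = {0}"
    by (auto simp: poly_eq_iff)
  then show ?case by simp
next
  case (Suc d)
  let ?S = "\<lambda>d. {h :: 'a poly. \<forall>i\<ge>d. poly.coeff h i = 0}"
  have "?S (Suc d) = (\<lambda>(a, h). pCons a h) ` (UNIV \<times> ?S d)"
  proof (intro equalityI subsetI)
    fix h assume h: "h \<in> ?S (Suc d)"
    obtain a g where g: "h = pCons a g"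
      by (cases h)
    have "poly.coeff g i = 0" if "i \<ge> d" for i
    proof -
      have "poly.coeff h (Suc i) = 0"
        using h that by auto
      then show ?thesis by (simp add: g)
    qed
    then show "h \<in> (\<lambda>(a, h). pCons a h) ` (UNIV \<times> ?S d)"
      unfolding g by auto
  next
    fix h assume "h \<in> (\<lambda>(a, h). pCons a h) ` (UNIV \<times> ?S d)"
    then show "h \<in> ?S (Suc d)"
      by (auto simp: coeff_pCons split: nat.splits)
  qed
  moreover have "inj_on (\<lambda>(a :: 'a, h). pCons a h) (UNIV \<times> ?S d)"
    by (auto simp: inj_on_def)
  ultimately show ?case
    by (simp add: card_image card_cartesian_product Suc)
qed

text \<open>The cofactor of \<open>g\<close> is determined by \<open>c\<close> and has
  \<open>n - degree g\<close> free coefficients. This turns the degree of a generator polynomial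
  into the dimension of its code.\<close>

lemma card_multiples_degree_less:
  fixes g :: "'a::{finite,field} poly"
  assumes "g \<noteq> 0" "degree g \<le> n" "n > 0"
  shows "card {c. degree c < n \<and> g dvd c} = card (UNIV :: 'a set) ^ (n - degree g)"
proof -
  let ?S = "{h :: 'a poly. \<forall>i\<ge>n - degree g. poly.coeff h i = 0}"
  have "{c. degree c < n \<and> g dvd c} = (\<lambda>h. g * h) ` ?S"
  proof (intro equalityI subsetI)
    fix c assume c: "c \<in> {c. degree c < n \<and> g dvd c}"
    then obtain h where h: "c = g * h" by auto
    have "poly.coeff h i = 0" if "i \<ge> n - degree g" for i
    proof (cases "h = 0")
      case False
      then have "degree g + degree h < n"
        using c h assms by (simp add: degree_mult_eq)
      then show ?thesis using that by (intro coeff_eq_0) linarith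
    qed simp
    then show "c \<in> (\<lambda>h. g * h) ` ?S" using h by auto
  next
    fix c assume "c \<in> (\<lambda>h. g * h) ` ?S"
    then obtain h where h: "c = g * h" "h \<in> ?S" by auto
    have "degree c < n"
    proof (cases "h = 0")
      case False
      then have "poly.coeff h (degree h) \<noteq> 0" by simp
      then have "degree h < n - degree g"
        using h(2) not_le by blast
      then show ?thesis using False assms h by (simp add: degree_mult_eq)
    qed (use h assms in auto)
    then show "c \<in> {c. degree c < n \<and> g dvd c}" using h by auto
  qed
  moreover have "inj_on (\<lambda>h. g * h) ?S"
    using assms by (auto simp: inj_on_def)
  ultimately show ?thesis
    by (simp add: card_image card_polys_coeff_bound)
qed

lemma degree_prod_linear:
  "degree (\<Prod>x\<in>R. [:- x, 1:] :: 'b::field poly) = card R"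
  by (subst degree_prod_eq_sum_degree) auto

lemma sum_cyclic_shift:
  fixes f :: "nat \<Rightarrow> 'c::comm_monoid_add"
  assumes "n > 0"
  shows "(\<Sum>k<n. f ((i + k) mod n)) = (\<Sum>k<n. f k)"
proof -
  have inj: "inj_on (\<lambda>k. (i + k) mod n) {..<n}"
    by (rule inj_onI) (metis cong_add_lcancel_nat cong_def lessThan_iff mod_less)
  have "(\<lambda>k. (i + k) mod n) ` {..<n} = {..<n}"
    using assms inj by (intro endo_inj_surj) auto
  then show ?thesis
    using sum.reindex[OF inj, of f] by simp
qed

section \<open>The extension of finite fields and its Frobenius map\<close>

locale finite_field_embedding =
  fixes emb :: "'a::{finite,field} \<Rightarrow> 'b::{finite,field}" and q :: nat
  assumes q_card: "q = card (UNIV :: 'a set)"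
    and emb_add: "\<And>x y. emb (x + y) = emb x + emb y"
    and emb_mult: "\<And>x y. emb (x * y) = emb x * emb y"
    and emb_one: "emb 1 = 1"
begin

definition ev :: "'a poly \<Rightarrow> 'b \<Rightarrow> 'b" where
  "ev p x = poly (map_poly emb p) x"

lemma emb_zero [simp]: "emb 0 = 0"
  using emb_add[of 0 0] by (metis add.right_neutral add_left_cancel)

lemma emb_uminus: "emb (- x) = - emb x"
  using emb_add[of x "- x"] by (simp add: eq_neg_iff_add_eq_0 add.commute)

lemma emb_eq_0_iff [simp]: "emb x = 0 \<longleftrightarrow> x = 0"
proof
  assume "emb x = 0"
  then show "x = 0"
    using emb_mult[of x "inverse x"] emb_one by (cases "x = 0") auto
qed simp

lemma inj_emb: "inj emb"
proof (rule injI)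
  fix x y assume "emb x = emb y"
  then have "emb (x - y) = 0"
    using emb_add[of x "- y"] emb_uminus[of y] by simp
  then show "x = y" by simp
qed

lemma emb_power: "emb (x ^ k) = emb x ^ k"
  by (induction k) (auto simp: emb_one emb_mult)

lemma q_gt_1: "q > 1"
proof -
  have "card {0, 1 :: 'a} \<le> card (UNIV :: 'a set)"
    by (intro card_mono) auto
  then show ?thesis using q_card by simp
qed

lemma map_emb_mult: "map_poly emb (p * r) = map_poly emb p * map_poly emb r"
  by (intro map_poly_hom_mult emb_add emb_mult) auto

lemma map_emb_add: "map_poly emb (p + r) = map_poly emb p + map_poly emb r"
  by (intro map_poly_hom_add emb_add) auto

lemma degree_map_emb: "degree (map_poly emb p) = degree p"
  by (intro degree_map_poly) auto

lemma map_emb_eq_0_iff: "map_poly emb p = 0 \<longleftrightarrow> p = 0"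
  by (intro map_poly_eq_0_iff) auto

lemma ev_mult: "ev (p * r) x = ev p x * ev r x"
  by (simp add: ev_def map_emb_mult)

lemma ev_add: "ev (p + r) x = ev p x + ev r x"
  by (simp add: ev_def map_emb_add)

lemma ev_0 [simp]: "ev 0 x = 0"
  by (simp add: ev_def)

lemma ev_conv_sum:
  assumes "degree c < n"
  shows "ev c x = (\<Sum>i<n. emb (poly.coeff c i) * x ^ i)"
proof -
  have "ev c x = (\<Sum>i\<le>degree c. emb (poly.coeff c i) * x ^ i)"
    by (simp add: ev_def poly_altdef degree_map_emb coeff_map_poly)
  also have "\<dots> = (\<Sum>i<n. emb (poly.coeff c i) * x ^ i)"
    using assms by (intro sum.mono_neutral_left) (auto simp: coeff_eq_0)
  finally show ?thesis .
qed

text \<open>The polynomial $(X+1)^q - X^q - 1$ over the small field has degree below $q$ but $q$ zeros.\<close>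
lemma frobenius_one_add: "(1 + y :: 'b) ^ q = 1 + y ^ q"
proof -
  define P :: "'a poly" where "P = (\<Sum>k\<in>{1..<q}. Polynomial.monom (of_nat (q choose k)) k)"
  have binom: "(1 + z) ^ q = 1 + (\<Sum>k\<in>{1..<q}. of_nat (q choose k) * z ^ k) + z ^ q"
    for z :: "'c::comm_ring_1"
  proof -
    have "{..q} = insert 0 (insert q {1..<q})" using q_gt_1 by auto
    moreover have "(1 + z) ^ q = (\<Sum>k\<le>q. of_nat (q choose k) * z ^ k)"
      by (subst add.commute, subst binomial_ring) simp
    ultimately show ?thesis using q_gt_1 by (simp add: algebra_simps)
  qed
  have "poly P x = 0" for x
    using binom[of x] finite_field_power_card[of x] finite_field_power_card[of "1 + x"] q_card
    by (simp add: P_def poly_sum poly_monom algebra_simps)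
  moreover have "degree P < card (UNIV :: 'a set)"
  proof -
    have "degree P \<le> q - 1"
      unfolding P_def by (intro degree_sum_le) (auto intro: order.trans[OF degree_monom_le])
    then show ?thesis using q_gt_1 q_card by linarith
  qed
  ultimately have P0: "P = 0"
    using card_poly_roots_bound[of P] by fastforce
  \<comment> \<open>The binomial coefficients vanish in the small field, being coefficients of
    \<open>P\<close>; \<open>emb\<close> respects images of natural numbers and carries this to the
    large field.\<close>
  have "of_nat (q choose k) = (0 :: 'b)" if "k \<in> {1..<q}" for k
  proof -
    have "poly.coeff P k = of_nat (q choose k)"
      using that by (simp add: P_def coeff_sum)
    then have "of_nat (q choose k) = (0 :: 'a)" using P0 by simp
    moreover have "emb (of_nat j) = of_nat j" for j
      by (induction j) (auto simp: emb_add emb_one)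
    ultimately show ?thesis by (metis emb_zero)
  qed
  then show ?thesis by (simp add: binom[of y])
qed

lemma frobenius_add: "(x + y :: 'b) ^ q = x ^ q + y ^ q"
proof (cases "x = 0")
  case False
  have "(x + y) ^ q = (x * (1 + y / x)) ^ q" using False by (simp add: algebra_simps)
  also have "\<dots> = x ^ q * (1 + (y / x) ^ q)" by (simp only: power_mult_distrib frobenius_one_add)
  also have "\<dots> = x ^ q + y ^ q" using False by (simp add: field_simps)
  finally show ?thesis .
qed (use q_gt_1 in simp)

lemma frobenius_zero: "(0 :: 'b) ^ q = 0"
  using q_gt_1 by simp

lemma frobenius_uminus: "(- x :: 'b) ^ q = - (x ^ q)"
  using frobenius_add[of x "- x"] frobenius_zero by (simp add: eq_neg_iff_add_eq_0 add.commute)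

lemma inj_frobenius: "inj (\<lambda>x :: 'b. x ^ q)"
proof (rule injI)
  fix x y :: 'b assume "x ^ q = y ^ q"
  then have "(x - y) ^ q = 0"
    using frobenius_add[of x "- y"] frobenius_uminus[of y] by simp
  then show "x = y" by simp
qed

text \<open>The \<open>q\<close> elements of \<open>range emb\<close> are roots of X^q - X, which
  has at most \<open>q\<close> roots.\<close>

lemma frobenius_fixed_iff: "(y :: 'b) ^ q = y \<longleftrightarrow> y \<in> range emb"
proof -
  let ?F = "{y :: 'b. y ^ q = y}"
  have sub: "range emb \<subseteq> ?F"
    by (auto simp: emb_power[symmetric] q_card finite_field_power_card)
  define P :: "'b poly" where "P = Polynomial.monom 1 q + Polynomial.monom (-1) 1"
  have "degree P \<le> q"
    unfolding P_def using q_gt_1 by (intro degree_add_le) (auto intro: order.trans[OF degree_monom_le])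
  moreover have "P \<noteq> 0"
  proof
    assume "P = 0"
    then have "poly.coeff P q = 0" by simp
    then show False using q_gt_1 by (simp add: P_def)
  qed
  moreover have "?F = {x. poly P x = 0}"
    by (auto simp: P_def poly_monom)
  ultimately have "card ?F \<le> q"
    using card_poly_roots_bound[of P] by simp
  moreover have "card (range emb) = q"
    using inj_emb by (simp add: card_image q_card)
  ultimately have "range emb = ?F"
    using sub by (intro card_seteq) auto
  then show ?thesis by auto
qed

section \<open>Polynomials over the small field with prescribed roots\<close>

definition frob_closed :: "'b set \<Rightarrow> bool" where
  "frob_closed R \<longleftrightarrow> (\<forall>x\<in>R. x ^ q \<in> R)"

text \<open>The Frobenius map is injective and \<open>R\<close> is finite, so a closed
  \<open>R\<close> is permuted. The product is therefore unchanged when its coefficients are raised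
  to the power \<open>q\<close>, and fixed coefficients come from the small field.\<close>

lemma descend_prod_linear:
  assumes "frob_closed R"
  shows "\<exists>G. lead_coeff G = 1 \<and> map_poly emb G = (\<Prod>x\<in>R. [:- x, 1:])"
proof -
  define P where "P = (\<Prod>x\<in>R. [:- x, 1:])"
  let ?f = "\<lambda>x :: 'b. x ^ q"
  have im: "?f ` R = R"
    using assms inj_frobenius by (intro endo_inj_surj) (auto simp: frob_closed_def intro: inj_on_subset)
  have one: "map_poly ?f 1 = 1"
    by (simp add: map_poly_1 pCons_one)
  have "map_poly ?f (\<Prod>x\<in>S. [:- x, 1:]) = (\<Prod>x\<in>S. [:- (x ^ q), 1:])" for S :: "'b set"
  proof (induction S rule: infinite_finite_induct)
    case (insert x F)
    have "map_poly ?f [:- x, 1:] = [:- (x ^ q), 1:]"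
      by (simp add: map_poly_pCons frobenius_zero frobenius_uminus)
    then show ?case
      using insert map_poly_hom_mult[of ?f, OF frobenius_add power_mult_distrib frobenius_zero]
      by (simp del: mult_pCons_left)
  qed (auto simp: one)
  then have "map_poly ?f P = (\<Prod>x\<in>R. [:- (?f x), 1:])"
    unfolding P_def .
  also have "\<dots> = (\<Prod>x\<in>?f ` R. [:- x, 1:])"
    using inj_frobenius by (subst prod.reindex) (auto intro: inj_on_subset)
  finally have fixP: "map_poly ?f P = P"
    unfolding im P_def .
  have "poly.coeff P i \<in> range emb" for i
  proof -
    have "poly.coeff P i ^ q = poly.coeff (map_poly ?f P) i"
      by (simp add: coeff_map_poly frobenius_zero)
    then show ?thesis
      using fixP frobenius_fixed_iff by simp
  qed
  then have inv: "emb (inv_into UNIV emb (poly.coeff P i)) = poly.coeff P i" for i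
    by (simp add: f_inv_into_f)
  have inv0: "inv_into UNIV emb 0 = 0"
    using inv_f_f[OF inj_emb, of 0] by simp
  define G where "G = map_poly (inv_into UNIV emb) P"
  have map: "map_poly emb G = P"
    by (rule poly_eqI) (simp add: G_def coeff_map_poly inv inv0)
  have "emb (lead_coeff G) = lead_coeff P"
    using map degree_map_emb[of G] coeff_map_poly[of emb G "degree G"] by simp
  also have "\<dots> = 1"
    unfolding P_def by (simp add: lead_coeff_prod)
  finally have "emb (lead_coeff G) = emb 1" by (simp add: emb_one)
  then have "lead_coeff G = 1" using inj_emb by (simp only: inj_eq)
  then show ?thesis using map P_def by blast
qed

text \<open>For the converse, the remainder modulo \<open>G\<close> vanishes on all of
  \<open>R\<close> but has degree below \<open>card R\<close>.\<close>

lemma dvd_iff_roots: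
  assumes G: "map_poly emb G = (\<Prod>x\<in>R. [:- x, 1:])"
  shows "G dvd p \<longleftrightarrow> (\<forall>x\<in>R. ev p x = 0)"
proof -
  have root: "ev G x = 0" if "x \<in> R" for x
    using that by (auto simp: ev_def G poly_prod)
  have degG: "degree G = card R"
    using degree_map_emb[of G] G degree_prod_linear[of R] by simp
  have G0: "G \<noteq> 0"
  proof
    assume "G = 0"
    then have "(\<Prod>x\<in>R. [:- x, 1:]) = 0" using G by simp
    then show False by simp
  qed
  show ?thesis
  proof
    assume "G dvd p"
    then show "\<forall>x\<in>R. ev p x = 0" using root by (auto simp: dvd_def ev_mult)
  next
    assume p: "\<forall>x\<in>R. ev p x = 0"
    define r where "r = p mod G"
    have "ev p x = ev G x * ev (p div G) x + ev (p mod G) x" for x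
      by (metis ev_add ev_mult mult_div_mod_eq)
    then have "ev r x = 0" if "x \<in> R" for x
      using p root that by (simp add: r_def)
    then have "card R \<le> card {x. poly (map_poly emb r) x = 0}"
      by (intro card_mono) (auto simp: ev_def)
    moreover have "card {x. poly (map_poly emb r) x = 0} \<le> degree r" if "r \<noteq> 0"
      using card_poly_roots_bound[of "map_poly emb r"] that map_emb_eq_0_iff degree_map_emb
      by simp
    moreover have "r = 0 \<or> degree r < degree G"
      unfolding r_def using G0 by (rule degree_mod_less)
    ultimately have "r = 0" using degG by fastforce
    then show "G dvd p" by (auto simp: r_def)
  qed
qed

text \<open>The coefficients come from the small field, so Frobenius fixes them. Roots are thus
  carried to roots, which makes whole cyclotomic cosets of zeros appear.\<close>

lemma ev_frobenius: "ev p (x ^ q) = ev p x ^ q"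
proof -
  have "map_poly (\<lambda>x. x ^ q) (map_poly emb p) = map_poly emb p"
    by (rule poly_eqI) (auto simp: coeff_map_poly frobenius_zero frobenius_fixed_iff)
  then show ?thesis
    using poly_map_poly_hom[of "\<lambda>x. x ^ q", OF frobenius_add power_mult_distrib frobenius_zero,
        of "map_poly emb p" x]
    by (simp add: ev_def)
qed

lemma ev_frobenius_power:
  assumes "ev p x = 0"
  shows "ev p (x ^ (q ^ s)) = 0"
  using assms q_gt_1
  by (induction s) (auto simp: mult.commute[of q] power_mult ev_frobenius)

text \<open>First the choice operator needs a witness: an annihilating polynomial of least degree,
  made monic. Then division with remainder applies, since a nonzero remainder would be annihilating
  of smaller degree.\<close>

lemma minimal_poly_dvd_iff: "minimal_poly emb x dvd p \<longleftrightarrow> ev p x = 0"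
proof -
  let ?Q = "\<lambda>p. p \<noteq> 0 \<and> poly (map_poly emb p) x = 0"
  let ?M = "\<lambda>p. p \<noteq> 0 \<and> lead_coeff p = 1 \<and> poly (map_poly emb p) x = 0 \<and>
      (\<forall>r. r \<noteq> 0 \<and> poly (map_poly emb r) x = 0 \<longrightarrow> degree p \<le> degree r)"
  \<comment> \<open>The polynomial with every element of the large field as a root annihilates
    \<open>x\<close>, so a least degree exists.\<close>
  obtain G where G: "lead_coeff G = 1" "map_poly emb G = (\<Prod>x\<in>UNIV. [:- x, 1:])"
    using descend_prod_linear[of UNIV] by (auto simp: frob_closed_def)
  have "?Q G" using G by (auto simp: poly_prod)
  then obtain p0 where p0: "?Q p0" "\<And>r. ?Q r \<Longrightarrow> degree p0 \<le> degree r"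
    using ex_has_least_nat[of ?Q G degree] by blast
  define p1 where "p1 = Polynomial.smult (inverse (lead_coeff p0)) p0"
  have "?M p1"
    using p0 ev_mult[of "[:inverse (lead_coeff p0):]" p0 x]
    by (auto simp: p1_def ev_def)
  then have M: "?M (minimal_poly emb x)"
    unfolding minimal_poly_def by (rule someI)
  let ?m = "minimal_poly emb x"
  show ?thesis
  proof
    assume "?m dvd p"
    then show "ev p x = 0" using M ev_mult by (auto simp: dvd_def ev_def)
  next
    assume p: "ev p x = 0"
    have "ev p x = ev ?m x * ev (p div ?m) x + ev (p mod ?m) x"
      by (metis ev_add ev_mult mult_div_mod_eq)
    then have "ev (p mod ?m) x = 0"
      using p M by (simp add: ev_def)
    moreover have "p mod ?m = 0 \<or> degree (p mod ?m) < degree ?m"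
      using M by (intro degree_mod_less) auto
    ultimately have "p mod ?m = 0"
      using M unfolding ev_def by (metis not_le)
    then show "?m dvd p" by auto
  qed
qed

section \<open>Codes given by their zeros: size, minimum distance and dual\<close>

definition root_code :: "nat \<Rightarrow> 'b set \<Rightarrow> 'a poly set" where
  "root_code n R = {c. degree c < n \<and> (\<forall>x\<in>R. ev c x = 0)}"

text \<open>A common multiple of the minimal polynomials is a polynomial vanishing at all conjugates
  of the chosen powers, and \<open>R\<close> consists of these. The descended product over
  \<open>R\<close> shows that the generator exists; its multiples are fixed by the defining
  property, whichever polynomial is chosen.\<close>

lemma bch_code_eq_root_code:
  assumes closed: "frob_closed R"
    and sub: "\<And>i. i \<in> {b..b + \<delta> - 2} \<Longrightarrow> \<beta> ^ i \<in> R"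
    and gen: "\<And>x. x \<in> R \<Longrightarrow> \<exists>i\<in>{b..b + \<delta> - 2}. \<exists>s. x = (\<beta> ^ i) ^ (q ^ s)"
  shows "bch_code n emb \<beta> \<delta> b = root_code n R"
proof -
  obtain G where G: "lead_coeff G = 1" "map_poly emb G = (\<Prod>x\<in>R. [:- x, 1:])"
    using descend_prod_linear[OF closed] by blast
  have iff: "(\<forall>i\<in>{b..b + \<delta> - 2}. minimal_poly emb (\<beta> ^ i) dvd p) \<longleftrightarrow> (\<forall>x\<in>R. ev p x = 0)" for p
    unfolding minimal_poly_dvd_iff using sub gen ev_frobenius_power by blast
  let ?P = "\<lambda>g. lead_coeff g = 1 \<and>
      (\<forall>p. g dvd p \<longleftrightarrow> (\<forall>i\<in>{b..b + \<delta> - 2}. minimal_poly emb (\<beta> ^ i) dvd p))"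
  have "?P G" using G dvd_iff_roots[OF G(2)] iff by simp
  then have "?P (bch_generator emb \<beta> \<delta> b)"
    unfolding bch_generator_def by (rule someI)
  then show ?thesis
    using iff by (auto simp: bch_code_def cyclic_code_def root_code_def)
qed

lemma card_root_code:
  assumes "frob_closed R" "card R \<le> n" "n > 0"
  shows "card (root_code n R) = q ^ (n - card R)"
proof -
  obtain G where G: "lead_coeff G = 1" "map_poly emb G = (\<Prod>x\<in>R. [:- x, 1:])"
    using descend_prod_linear[OF assms(1)] by blast
  have "degree G = card R"
    using degree_map_emb[of G] G degree_prod_linear[of R] by simp
  moreover have "G \<noteq> 0" using G by auto
  moreover have "root_code n R = {c. degree c < n \<and> G dvd c}"
    using dvd_iff_roots[OF G(2)] by (auto simp: root_code_def)
  ultimately show ?thesis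
    using card_multiples_degree_less[of G n] assms q_card by simp
qed

text \<open>The check equations are tested against the polynomial \<open>h\<close> that vanishes at all but one of the
  points \<open>\<beta> ^ s\<close> with \<open>s\<close> in the support of \<open>c\<close>.\<close>
lemma bch_bound:
  assumes inj: "inj_on (\<lambda>i. \<beta> ^ i) {..<n}" and b0: "\<beta> \<noteq> 0"
    and c: "degree c < n" "c \<noteq> 0"
    and roots: "\<And>i. i < d \<Longrightarrow> ev c (\<beta> ^ (b + i)) = 0"
  shows "hamming_weight c > d"
proof (rule ccontr)
  assume neg: "\<not> hamming_weight c > d"
  define S where "S = {i. poly.coeff c i \<noteq> 0}"
  have S: "S \<subseteq> {..<n}"
    using c(1) le_degree by (force simp: S_def)
  then have fin: "finite S" by (rule finite_subset) simp
  have card: "card S \<le> d" using neg by (simp add: hamming_weight_def S_def)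
  define s0 where "s0 = degree c"
  have s0: "s0 \<in> S" using c by (simp add: S_def s0_def)
  define h where "h = (\<Prod>s\<in>S - {s0}. [:- (\<beta> ^ s), 1:])"
  have "degree h = card (S - {s0})"
    unfolding h_def by (subst degree_prod_eq_sum_degree) auto
  also have "\<dots> < card S" using s0 fin by (meson card_Diff1_less)
  finally have degh: "degree h < d" using card by linarith
  have sum: "(\<Sum>s\<in>S. emb (poly.coeff c s) * (\<beta> ^ s) ^ (b + i)) = 0" if "i < d" for i
  proof -
    have "0 = (\<Sum>s<n. emb (poly.coeff c s) * (\<beta> ^ (b + i)) ^ s)"
      using roots[OF that] ev_conv_sum[OF c(1)] by simp
    also have "\<dots> = (\<Sum>s\<in>S. emb (poly.coeff c s) * (\<beta> ^ (b + i)) ^ s)"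
      using S by (intro sum.mono_neutral_right) (auto simp: S_def)
    also have "\<dots> = (\<Sum>s\<in>S. emb (poly.coeff c s) * (\<beta> ^ s) ^ (b + i))"
      by (intro sum.cong) (simp_all only: power_mult[symmetric] mult.commute)
    finally show ?thesis by simp
  qed
  have "(\<Sum>s\<in>S. emb (poly.coeff c s) * (\<beta> ^ s) ^ b * poly h (\<beta> ^ s))
      = (\<Sum>s\<in>S. \<Sum>i\<le>degree h. poly.coeff h i * (emb (poly.coeff c s) * (\<beta> ^ s) ^ (b + i)))"
    by (intro sum.cong) (auto simp: poly_altdef sum_distrib_left power_add mult_ac)
  also have "\<dots> = (\<Sum>i\<le>degree h. \<Sum>s\<in>S. poly.coeff h i * (emb (poly.coeff c s) * (\<beta> ^ s) ^ (b + i)))"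
    by (rule sum.swap)
  also have "\<dots> = 0"
    using sum degh by (intro sum.neutral) (auto simp: sum_distrib_left[symmetric])
  finally have "(\<Sum>s\<in>S. emb (poly.coeff c s) * (\<beta> ^ s) ^ b * poly h (\<beta> ^ s)) = 0" .
  \<comment> \<open>By construction \<open>h\<close> kills every term except the one at
    \<open>s0\<close>.\<close>
  moreover have "(\<Sum>s\<in>S. emb (poly.coeff c s) * (\<beta> ^ s) ^ b * poly h (\<beta> ^ s))
      = (\<Sum>s\<in>{s0}. emb (poly.coeff c s) * (\<beta> ^ s) ^ b * poly h (\<beta> ^ s))"
    using s0 fin by (intro sum.mono_neutral_right) (auto simp: h_def poly_prod)
  ultimately have "poly h (\<beta> ^ s0) = 0"
    using s0 b0 by (auto simp: S_def)
  then obtain s where "s \<in> S" "s \<noteq> s0" "\<beta> ^ s = \<beta> ^ s0"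
    using fin by (auto simp: h_def poly_prod eq_commute[of "\<beta> ^ s0"])
  then show False
    using inj S s0 by (auto dest!: inj_onD)
qed

text \<open>The discrete Fourier transform of the correlation of \<open>c\<close> and
  \<open>v\<close> is a product of values at opposite points; \<open>n - j\<close> plays the role of
  \<open>- j\<close>. If \<open>v\<close> is orthogonal to all cyclic shifts of \<open>c\<close>,
  every such product vanishes.\<close>

lemma fourier_shift_product:
  assumes n: "n > 0" and bn: "\<beta> ^ n = 1" and j: "j < n"
    and c: "degree c < n" and v: "degree v < n"
  shows "(\<Sum>k<n. \<beta> ^ (j * k) * (\<Sum>i<n. emb (poly.coeff c ((i + k) mod n)) * emb (poly.coeff v i)))
       = ev c (\<beta> ^ j) * ev v (\<beta> ^ (n - j))"
proof -
  have red: "\<beta> ^ (j * (x mod n)) = \<beta> ^ (j * x)" for x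
  proof -
    have "\<beta> ^ (j * x) = \<beta> ^ (j * (x mod n) + n * (j * (x div n)))"
      by (rule arg_cong[of _ _ "\<lambda>k. \<beta> ^ k"]) (metis distrib_left mod_mult_div_eq mult.left_commute)
    also have "\<dots> = \<beta> ^ (j * (x mod n))"
      by (simp only: power_add power_mult bn) simp
    finally show ?thesis by simp
  qed
  \<comment> \<open>The exponent is rewritten so that \<open>k\<close> enters only through the
    shifted index, after which the inner sum is a cyclic shift.\<close>
  have split: "\<beta> ^ (j * k) = \<beta> ^ ((n - j) * i) * \<beta> ^ (j * ((i + k) mod n))" for i k
  proof -
    have "(n - j) * i + j * (i + k) = n * i + j * k"
      using j by (subst (asm) less_iff_Suc_add) (auto simp: algebra_simps)
    then have "\<beta> ^ ((n - j) * i) * \<beta> ^ (j * (i + k)) = \<beta> ^ (n * i) * \<beta> ^ (j * k)"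
      by (simp only: power_add[symmetric])
    moreover have "\<beta> ^ (n * i) = 1" by (simp add: power_mult bn)
    ultimately show ?thesis by (simp only: red) simp
  qed
  have "(\<Sum>k<n. \<beta> ^ (j * k) * (\<Sum>i<n. emb (poly.coeff c ((i + k) mod n)) * emb (poly.coeff v i)))
     = (\<Sum>k<n. \<Sum>i<n. \<beta> ^ (j * k) * (emb (poly.coeff c ((i + k) mod n)) * emb (poly.coeff v i)))"
    by (simp add: sum_distrib_left)
  also have "\<dots> = (\<Sum>i<n. \<Sum>k<n. \<beta> ^ (j * k) * (emb (poly.coeff c ((i + k) mod n)) * emb (poly.coeff v i)))"
    by (rule sum.swap)
  also have "\<dots> = (\<Sum>i<n. emb (poly.coeff v i) * (\<beta> ^ (n - j)) ^ i *
      (\<Sum>k<n. (\<lambda>l. emb (poly.coeff c l) * (\<beta> ^ j) ^ l) ((i + k) mod n)))"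
  proof (intro sum.cong refl)
    fix i
    show "(\<Sum>k<n. \<beta> ^ (j * k) * (emb (poly.coeff c ((i + k) mod n)) * emb (poly.coeff v i)))
      = emb (poly.coeff v i) * (\<beta> ^ (n - j)) ^ i *
      (\<Sum>k<n. (\<lambda>l. emb (poly.coeff c l) * (\<beta> ^ j) ^ l) ((i + k) mod n))"
      unfolding sum_distrib_left power_mult[symmetric]
      by (intro sum.cong refl) (subst split[where i = i], simp add: mult_ac)
  qed
  also have "\<dots> = ev v (\<beta> ^ (n - j)) * ev c (\<beta> ^ j)"
    unfolding sum_cyclic_shift[OF n, of "\<lambda>l. emb (poly.coeff c l) * (\<beta> ^ j) ^ l"]
    by (simp only: ev_conv_sum[OF c] ev_conv_sum[OF v] sum_distrib_right)
  finally show ?thesis by (simp add: mult.commute)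
qed

text \<open>At an \<open>n\<close>-th root of unity a cyclic shift changes the value of a word only
  by a power of that root, so zeros are kept.\<close>

lemma root_code_cyclic:
  assumes n: "n > 0" and c: "c \<in> root_code n R" and R: "\<And>x. x \<in> R \<Longrightarrow> x ^ n = 1"
  shows "\<exists>d \<in> root_code n R. \<forall>i<n. poly.coeff d i = poly.coeff c ((i + k) mod n)"
proof -
  define d where "d = (\<Sum>i<n. Polynomial.monom (poly.coeff c ((i + k) mod n)) i)"
  have co: "poly.coeff d i = (if i < n then poly.coeff c ((i + k) mod n) else 0)" for i
    by (simp add: d_def coeff_sum)
  have deg: "degree d < n"
    using n by (intro degree_lessI) (auto simp: co)
  have "ev d x = 0" if x: "x \<in> R" for x
  proof -
    have xn: "x ^ n = 1" using R x by simp
    have red: "x ^ (l mod n) = x ^ l" for l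
    proof -
      have "x ^ l = x ^ (n * (l div n) + l mod n)" by simp
      also have "\<dots> = x ^ (l mod n)" by (simp only: power_add power_mult xn) simp
      finally show ?thesis by simp
    qed
    have "x ^ k * ev d x = (\<Sum>i<n. (\<lambda>l. emb (poly.coeff c l) * x ^ l) ((k + i) mod n))"
      unfolding ev_conv_sum[OF deg] sum_distrib_left red
      by (intro sum.cong) (auto simp: co power_add mult_ac add.commute)
    also have "\<dots> = ev c x"
      using c sum_cyclic_shift[OF n, of "\<lambda>l. emb (poly.coeff c l) * x ^ l" k]
      by (simp add: ev_conv_sum[of c n] root_code_def)
    also have "\<dots> = 0" using c x by (simp add: root_code_def)
    finally show ?thesis using xn n by (auto simp: zero_power)
  qed
  then have "d \<in> root_code n R" using deg by (simp add: root_code_def)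
  then show ?thesis using co by (intro bexI[of _ d]) auto
qed

text \<open>Let \<open>v\<close> lie in the code and in its dual, and let \<open>G\<close> be the
  generator. Orthogonality to all shifts of \<open>G\<close> gives
  \<open>ev G (\<beta> ^ j) * ev v (\<beta> ^ (n - j)) = 0\<close>. Outside \<open>R\<close>, which
  is closed under inverses, the first factor is nonzero, so \<open>v\<close> vanishes there; on
  \<open>R\<close> it vanishes as a codeword. Having \<open>n\<close> roots and degree below
  \<open>n\<close>, it is zero.\<close>

lemma root_code_LCD:
  assumes n: "n > 0" and bn: "\<beta> ^ n = 1" and inj: "inj_on (\<lambda>i. \<beta> ^ i) {..<n}"
    and closed: "frob_closed R" and R: "R \<subseteq> (\<lambda>i. \<beta> ^ i) ` {..<n}" "1 \<notin> R"
    and neg: "\<And>x. x \<in> R \<Longrightarrow> inverse x \<in> R"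
  shows "is_LCD n (root_code n R)"
proof -
  have pw: "(\<beta> ^ i) ^ n = 1" for i
    using bn by (metis mult.commute power_mult power_one)
  have b0: "\<beta> \<noteq> 0" using bn n by (auto simp: zero_power)
  have R1: "x ^ n = 1" if "x \<in> R" for x
    using R that pw by auto
  obtain G where G: "lead_coeff G = 1" "map_poly emb G = (\<Prod>x\<in>R. [:- x, 1:])"
    using descend_prod_linear[OF closed] by blast
  \<comment> \<open>As \<open>1\<close> is not in \<open>R\<close>, the generator has degree below
    \<open>n\<close> and is itself a codeword.\<close>
  have "card R < card ((\<lambda>i. \<beta> ^ i) ` {..<n})"
  proof (rule psubset_card_mono)
    have "1 \<in> (\<lambda>i. \<beta> ^ i) ` {..<n}" using n by (intro image_eqI[of _ _ 0]) auto
    then show "R \<subset> (\<lambda>i. \<beta> ^ i) ` {..<n}" using R by auto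
  qed auto
  then have cR: "card R < n" using inj by (simp add: card_image)
  have Gc: "G \<in> root_code n R"
  proof -
    have "degree G = card R"
      using degree_map_emb[of G] G degree_prod_linear[of R] by simp
    then show ?thesis using cR G by (auto simp: root_code_def ev_def poly_prod)
  qed
  have "v = 0" if v: "v \<in> root_code n R" and dual: "v \<in> dual_code n (root_code n R)" for v
  proof -
    have degs: "degree G < n" "degree v < n"
      using v Gc by (auto simp: root_code_def)
    have vj: "ev v (\<beta> ^ l) = 0" if l: "l < n" for l
    proof (cases "\<beta> ^ l \<in> R")
      case True
      then show ?thesis using v by (simp add: root_code_def)
    next
      case False
      \<comment> \<open>The residue of \<open>- l\<close>; the outer \<open>mod n\<close> matters
        only for \<open>l = 0\<close>.\<close>
      define j where "j = (n - l) mod n"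
      have j: "j < n" using n by (simp add: j_def)
      have jl: "\<beta> ^ j * \<beta> ^ l = 1"
        using l bn by (cases "l = 0") (auto simp: j_def power_add[symmetric])
      have nj: "\<beta> ^ (n - j) = \<beta> ^ l"
        using l bn by (cases "l = 0") (auto simp: j_def)
      have "inverse (\<beta> ^ j) = \<beta> ^ l"
        using jl by (simp add: inverse_unique)
      then have jR: "\<beta> ^ j \<notin> R" using neg False by metis
      have zero: "(\<Sum>i<n. emb (poly.coeff G ((i + k) mod n)) * emb (poly.coeff v i)) = 0" for k
      proof -
        obtain d where d: "d \<in> root_code n R" "\<forall>i<n. poly.coeff d i = poly.coeff G ((i + k) mod n)"
          using root_code_cyclic[OF n Gc R1] by blast
        have "(\<Sum>i<n. poly.coeff d i * poly.coeff v i) = 0"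
          using dual d(1) by (auto simp: dual_code_def)
        then have "emb (\<Sum>i<n. poly.coeff d i * poly.coeff v i) = 0" by simp
        moreover have "emb (sum h S) = (\<Sum>x\<in>S. emb (h x))" for h :: "nat \<Rightarrow> 'a" and S
          by (induction S rule: infinite_finite_induct) (auto simp: emb_add)
        ultimately show ?thesis using d(2) by (simp add: emb_mult)
      qed
      have "ev G (\<beta> ^ j) * ev v (\<beta> ^ (n - j)) = 0"
        using fourier_shift_product[OF n bn j degs] by (simp add: zero)
      moreover have "ev G (\<beta> ^ j) \<noteq> 0"
        using jR by (auto simp: ev_def G poly_prod)
      ultimately show ?thesis by (simp add: nj)
    qed
    have "map_poly emb v = 0"
    proof (rule ccontr)
      assume nz: "map_poly emb v \<noteq> 0"
      have "n = card ((\<lambda>i. \<beta> ^ i) ` {..<n})" using inj by (simp add: card_image)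
      also have "\<dots> \<le> card {x. poly (map_poly emb v) x = 0}"
        using vj by (intro card_mono) (auto simp: ev_def)
      also have "\<dots> \<le> degree v"
        using card_poly_roots_bound[OF nz] by (simp add: degree_map_emb)
      finally show False using degs by simp
    qed
    then show "v = 0" by (simp add: map_emb_eq_0_iff)
  qed
  moreover have "0 \<in> root_code n R" "0 \<in> dual_code n (root_code n R)"
    using n by (auto simp: root_code_def dual_code_def)
  ultimately show ?thesis by (auto simp: is_LCD_def)
qed

end

section \<open>Cyclotomic cosets modulo n\<close>

lemma card_not_dvd_atLeastAtMost:
  fixes q N :: int
  assumes "q > 0" "N \<ge> 0"
  shows "int (card {i\<in>{1..N}. \<not> q dvd i}) = N - N div q"
proof -
  have "{i\<in>{1..N}. q dvd i} = (\<lambda>k. q * k) ` {1..N div q}"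
  proof (intro equalityI subsetI)
    fix i assume "i \<in> {i\<in>{1..N}. q dvd i}"
    then obtain k where k: "i = q * k" "1 \<le> q * k" "q * k \<le> N" by auto
    have "k \<ge> 1" using k assms by (smt (verit) mult_nonneg_nonpos)
    moreover have "k \<le> N div q"
      using zdiv_mono1[OF k(3), of q] assms by simp
    ultimately show "i \<in> (\<lambda>k. q * k) ` {1..N div q}" using k by auto
  next
    fix i assume "i \<in> (\<lambda>k. q * k) ` {1..N div q}"
    then obtain k where k: "i = q * k" "1 \<le> k" "k \<le> N div q"
      by (metis atLeastAtMost_iff imageE)
    have "q * k \<le> q * (N div q)" using k assms by (intro mult_left_mono) auto
    also have "\<dots> \<le> N" using assms mult_div_mod_eq[of q N] pos_mod_sign[of q N] by linarith
    finally show "i \<in> {i\<in>{1..N}. q dvd i}"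
      using k assms by (auto simp: int_one_le_iff_zero_less)
  qed
  moreover have "inj_on (\<lambda>k. q * k) {1..N div q}" using assms by (auto simp: inj_on_def)
  ultimately have c: "card {i\<in>{1..N}. q dvd i} = nat (N div q)" by (simp add: card_image)
  have fin: "finite {i\<in>{1..N}. q dvd i}" by (rule finite_Collect_conjI) simp
  have "{i\<in>{1..N}. \<not> q dvd i} = {1..N} - {i\<in>{1..N}. q dvd i}" by auto
  then have "card {i\<in>{1..N}. \<not> q dvd i} = nat N - nat (N div q)"
    using c card_Diff_subset[OF fin, of "{1..N}"] by force
  moreover have "N div q \<le> N" "0 \<le> N div q"
    using assms zdiv_mono2[of N 1 q] by (auto simp: pos_imp_zdiv_nonneg_iff)
  ultimately show ?thesis using assms by simp
qed

text \<open>With \<open>N = \<delta> - 1\<close> this identifies \<epsilon> with the number of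
  positive integers below \<delta> that \<open>q\<close> does not divide.\<close>

lemma ceiling_mult_one_minus_inverse:
  fixes q N :: int
  assumes "q > 0"
  shows "\<lceil>real_of_int N * (1 - 1 / real_of_int q)\<rceil> = N - N div q"
proof -
  have "real_of_int N * (1 - 1 / real_of_int q) = real_of_int N + - (real_of_int N / real_of_int q)"
    by (simp add: right_diff_distrib)
  also have "\<lceil>\<dots>\<rceil> = N - \<lfloor>real_of_int N / real_of_int q\<rfloor>"
    by (simp add: ceiling_def)
  finally show ?thesis by (simp add: floor_divide_of_int_eq)
qed

section \<open>Size and divisibility of the parameters, and coincidences of small residues\<close>

locale bch_params =
  fixes q t n \<delta> :: nat and Q a r \<sigma> :: int
  assumes q_ge: "q \<ge> 5" and t_ge: "t \<ge> 2"
    and Q_def: "Q = int q ^ t" and \<sigma>: "\<sigma> = 1 \<or> \<sigma> = -1"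
    and r_eq: "(int q + 1) * r = Q + \<sigma>" and a_def: "a = Q - r"
    and n_eq: "int n = Q * a + \<sigma> * r"
    and \<delta>_ge: "Q + 2 \<le> int \<delta>" and \<delta>_le: "int \<delta> \<le> 2 * a - 1"
begin

lemma Q_ge: "Q \<ge> 25"
proof -
  have "(5::int) ^ 2 \<le> int q ^ 2" using q_ge by (intro power_mono) auto
  also have "\<dots> \<le> int q ^ t" using q_ge t_ge by (intro power_increasing) auto
  finally show ?thesis by (simp add: Q_def)
qed

lemma r_bounds: "1 \<le> r" "5 * r \<le> Q"
proof -
  have pos: "(int q + 1) * r > 0" using r_eq Q_ge \<sigma> by auto
  then show 1: "1 \<le> r" by (auto simp: zero_less_mult_iff)
  have "6 * r \<le> (int q + 1) * r" using q_ge 1 by (intro mult_right_mono) auto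
  then show "5 * r \<le> Q" using r_eq \<sigma> 1 by auto
qed

lemma a_bounds: "5 * a \<ge> 4 * Q" "a < Q"
  using r_bounds by (auto simp: a_def)

lemma Qa_ge: "Q * a \<ge> 25 * a"
  using Q_ge a_bounds by (intro mult_right_mono) auto

lemma \<sigma>r: "\<bar>\<sigma> * r\<bar> = r"
  using \<sigma> r_bounds by auto

lemma n_gt: "int n > 2 * a"
  using n_eq Qa_ge \<sigma>r r_bounds a_bounds by linarith

lemma q_dvd_Q: "int q dvd Q"
  unfolding Q_def using t_ge by (intro dvd_power) auto

text \<open>Modulo \<open>q\<close> one has \<open>r = \<sigma>\<close> and
  \<open>a = - \<sigma>\<close>, so the four numbers are congruent to \<sigma>,
  \<open>- \<sigma>\<close>, \<open>- 2 * \<sigma>\<close> and \<sigma>, all nonzero because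
  \<open>q \<ge> 5\<close>.\<close>

lemma not_q_dvd: "\<not> int q dvd r" "\<not> int q dvd a" "\<not> int q dvd a - \<sigma>" "\<not> int q dvd Q + r"
  and q_dvd_a_add: "int q dvd a + \<sigma>"
proof -
  have small: "\<not> int q dvd x" if "x \<noteq> 0" "\<bar>x\<bar> \<le> 2" for x
    using that q_ge zdvd_imp_le[of "int q" "\<bar>x\<bar>"] by fastforce
  have r: "int q dvd r - \<sigma>"
  proof -
    have "r - \<sigma> = Q - int q * r" using r_eq by (simp add: algebra_simps)
    then show ?thesis using q_dvd_Q by simp
  qed
  show 1: "\<not> int q dvd r"
    using r small[of \<sigma>] \<sigma> dvd_diff[of "int q" r "r - \<sigma>"] by auto
  show "\<not> int q dvd a"
    using 1 q_dvd_Q dvd_diff[of "int q" Q a] by (auto simp: a_def)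
  show "\<not> int q dvd Q + r"
    using 1 q_dvd_Q by (simp add: dvd_add_right_iff)
  have "a + \<sigma> = Q - (r - \<sigma>)" by (simp add: a_def)
  then show 2: "int q dvd a + \<sigma>" using r q_dvd_Q by (metis dvd_diff)
  show "\<not> int q dvd a - \<sigma>"
    using 2 small[of "2 * \<sigma>"] \<sigma> dvd_diff[of "int q" "a + \<sigma>" "a - \<sigma>"] by auto
qed

text \<open>Write the difference as \<open>n * k\<close>. Size leaves \<open>k = 0\<close> or
  \<open>k = 1\<close>. In the first case a positive \<open>s\<close> would make \<open>q\<close>
  divide \<open>j\<close>. In the second, \<open>s = t\<close> and
  \<open>Q * (i - a) = \<sigma> * r + \<kappa> * j\<close>, whose right side is below
  \<open>2 * Q\<close> in absolute value, so \<open>i\<close> differs from \<open>a\<close> by at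
  most one.\<close>

lemma small_representatives:
  fixes i j \<kappa> :: int
  assumes i: "1 \<le> i" "i \<le> 2 * a - 2" "\<not> int q dvd i"
    and j: "1 \<le> j" "j \<le> 2 * a - 2" "\<not> int q dvd j"
    and s: "s \<le> t" and \<kappa>: "\<kappa> = 1 \<or> \<kappa> = -1"
    and dvd: "int n dvd i * int q ^ s - \<kappa> * j"
  shows "s = 0 \<and> i = j \<and> \<kappa> = 1 \<or> i = a \<and> j = r \<or> i = a - \<sigma> \<and> j = Q + r"
proof -
  define y where "y = int q ^ s"
  obtain k where k: "i * y - \<kappa> * j = int n * k" using dvd by (auto simp: y_def)
  have y1: "1 \<le> y" using q_ge by (simp add: y_def)
  have yQ: "y \<le> Q" unfolding y_def Q_def using q_ge s by (intro power_increasing) auto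
  have iy: "i * y \<le> (2 * a - 2) * y" "0 \<le> i * y" using i y1 by (auto intro: mult_right_mono)
  have "(2 * a - 2) * y \<le> (2 * a - 2) * Q" using i j yQ by (intro mult_left_mono) auto
  then have iyQ: "i * y \<le> 2 * (Q * a) - 2 * Q" using iy by (simp add: algebra_simps)
  have \<kappa>j: "\<bar>\<kappa> * j\<bar> = j" using \<kappa> j by auto
  \<comment> \<open>What is needed is \<open>2 * a - 2 < 2 * Q - 2 * r\<close>. The right side
    equals \<open>2 * a\<close>, so the upper bound on \<open>i\<close> and \<open>j\<close> is just
    small enough.\<close>
  have up: "int n * k < int n * 2"
    using k iyQ \<kappa>j j n_eq \<sigma>r a_def by linarith
  have lo: "int n * (-1) < int n * k"
    using k iy \<kappa>j j n_gt by linarith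
  have "k = 0 \<or> k = 1"
    using up lo by (simp only: mult_less_cancel_left) linarith
  then show ?thesis
  proof
    assume "k = 0"
    then have eq: "i * y = \<kappa> * j" using k by simp
    have "i * y \<ge> 1" using mult_mono[of 1 i 1 y] i y1 by simp
    then have \<kappa>1: "\<kappa> = 1" using eq \<kappa> j by auto
    have "s = 0"
    proof (rule ccontr)
      assume "s \<noteq> 0"
      then have "int q dvd y" unfolding y_def by (intro dvd_power) auto
      then have "int q dvd i * y" by simp
      then show False using eq \<kappa>1 j by simp
    qed
    then show ?thesis using eq \<kappa>1 by (auto simp: y_def)
  next
    assume "k = 1"
    then have eq: "i * y - \<kappa> * j = Q * a + \<sigma> * r" using k n_eq by simp
    \<comment> \<open>For smaller \<open>s\<close> one has \<open>5 * y \<le> Q\<close>, and then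
      \<open>i * y\<close> stays below about two fifths of \<open>n\<close>.\<close>
    have "s = t"
    proof (rule ccontr)
      assume "s \<noteq> t"
      then have "int q ^ Suc s \<le> Q" unfolding Q_def using q_ge s by (intro power_increasing) auto
      moreover have "5 * y \<le> int q * y" using q_ge y1 by (intro mult_right_mono) auto
      ultimately have "5 * y \<le> Q" by (simp add: y_def)
      then have "(2 * a - 2) * (5 * y) \<le> (2 * a - 2) * Q" using i by (intro mult_left_mono) auto
      then have "5 * (i * y) \<le> 2 * (Q * a) - 2 * Q" using iy by (simp add: algebra_simps)
      then show False using eq \<kappa>j j \<sigma>r Qa_ge a_bounds Q_ge r_bounds by linarith
    qed
    then have "y = Q" by (simp add: y_def Q_def)
    then have eq2: "Q * (i - a) = \<sigma> * r + \<kappa> * j" using eq by (simp add: algebra_simps)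
    have "Q * (i - a) < Q * 2" "Q * (-2) < Q * (i - a)"
      using eq2 \<kappa>j \<sigma>r j a_def r_bounds by linarith+
    then have "i - a < 2" "-2 < i - a"
      using Q_ge by (simp_all only: mult_less_cancel_left)
    then consider "i = a" | "i = a + 1" | "i = a - 1" by linarith
    then show ?thesis
    proof cases
      case 1
      then show ?thesis using eq2 \<sigma> \<kappa> j r_bounds by auto
    next
      case 2
      then have e: "Q = \<sigma> * r + \<kappa> * j" using eq2 by simp
      \<comment> \<open>Since \<open>q\<close> divides \<open>a + \<sigma>\<close> but not
        \<open>i\<close>, only the neighbour \<open>a - \<sigma>\<close> of \<open>a\<close> can
        occur.\<close>
      have "\<sigma> = -1" using \<sigma> i(3) q_dvd_a_add 2 by auto
      then show ?thesis using e 2 \<kappa> j r_bounds Q_ge by auto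
    next
      case 3
      then have e: "- Q = \<sigma> * r + \<kappa> * j" using eq2 by simp
      have "\<sigma> = 1" using \<sigma> i(3) q_dvd_a_add 3 by auto
      then show ?thesis using e 3 \<kappa> j r_bounds Q_ge by auto
    qed
  qed
qed

section \<open>Cosets of the representatives and their sizes\<close>

definition m :: nat where "m = 2 * t + 1"

text \<open>One member of each exceptional pair of \<open>small_representatives\<close> is left out:
  \<open>a\<close> in favour of \<open>r\<close>, and \<open>Q + r\<close> in favour of
  \<open>a - \<sigma>\<close>.\<close>

definition reps :: "int set" where
  "reps = {i\<in>{1..int \<delta> - 1}. \<not> int q dvd i} - {a, Q + r}"

text \<open>Formulated on all integers so that negation can be applied directly; reduction to
  residues happens only in \<open>defining_set\<close>.\<close>

definition in_orbit :: "int \<Rightarrow> bool" where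
  "in_orbit x \<longleftrightarrow> (\<exists>i\<in>reps. \<exists>s. [x = i * int q ^ s] (mod int n))"

definition defining_set :: "nat set" where
  "defining_set = {x. x < n \<and> in_orbit (int x)}"

lemma repsD:
  assumes "i \<in> reps"
  shows "1 \<le> i" "i \<le> int \<delta> - 1" "i \<le> 2 * a - 2" "\<not> int q dvd i" "i \<noteq> a" "i \<noteq> Q + r"
  using assms \<delta>_le by (auto simp: reps_def)

text \<open>Multiply \<open>n = Q * a + \<sigma> * r\<close> by \<open>q + 1\<close>: the terms
  \<open>- \<sigma> * Q\<close> and \<open>\<sigma> * Q\<close> cancel, and
  \<open>\<sigma> * \<sigma> = 1\<close> remains beside \<open>q * Q * Q\<close>.\<close>

lemma q_power_m_eq: "int q ^ m = (int q + 1) * int n - 1"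
proof -
  have "(int q + 1) * a = int q * Q - \<sigma>"
    using r_eq by (simp add: a_def algebra_simps)
  then have "(int q + 1) * int n = Q * (int q * Q - \<sigma>) + \<sigma> * (Q + \<sigma>)"
    unfolding n_eq by (simp add: distrib_left mult.left_commute r_eq[symmetric])
  also have "\<dots> = int q * (Q * Q) + \<sigma> * \<sigma>" by (simp add: algebra_simps)
  also have "\<sigma> * \<sigma> = 1" using \<sigma> by auto
  also have "int q * (Q * Q) = int q ^ m"
    by (simp add: Q_def m_def power_add mult_2)
  finally show ?thesis by simp
qed

lemma q_power_m: "[int q ^ m = - 1] (mod int n)"
  unfolding q_power_m_eq by (simp add: cong_iff_dvd_diff)

lemma q_power_2m: "[int q ^ (2 * m) = 1] (mod int n)"
  using cong_mult[OF q_power_m q_power_m] by (simp add: mult_2 power_add)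

lemma coprime_q_n: "coprime q n"
proof -
  have "coprime (int q ^ m) (int n)"
    using q_power_m cong_imp_coprime[of "-1" "int q ^ m" "int n"] by (simp add: cong_sym)
  then show ?thesis by (simp add: m_def)
qed

lemma cong_cancel_q_power:
  "[x * int q ^ s = y * int q ^ s] (mod int n) \<longleftrightarrow> [x = y] (mod int n)"
  using coprime_q_n by (intro cong_mult_rcancel) simp

text \<open>Since \<open>q ^ m\<close> is \<open>- 1\<close> modulo \<open>n\<close>, the exponent
  drops below \<open>m\<close> at the cost of a sign \<kappa>. Then
  \<open>small_representatives\<close> applies, possibly with \<open>i\<close> and \<open>j\<close>
  exchanged, and its exceptional pairs contain a number removed from \<open>reps\<close>.\<close>

lemma reps_power_cong:
  assumes i: "i \<in> reps" and j: "j \<in> reps" and d: "d < 2 * m"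
    and cong: "[i * int q ^ d = j] (mod int n)"
  shows "i = j \<and> d = 0"
proof -
  obtain \<kappa> e where \<kappa>: "\<kappa> = (1::int) \<or> \<kappa> = -1" and e: "e < m" "d = e \<and> \<kappa> = 1 \<or> d = m + e \<and> \<kappa> = -1"
    and ce: "[i * int q ^ e = \<kappa> * j] (mod int n)"
  proof (cases "d < m")
    case True
    then show ?thesis using that[of 1 d] cong by simp
  next
    case False
    then obtain e where e: "d = m + e" by (metis le_add_diff_inverse not_le)
    have "[i * (int q ^ e * int q ^ m) = i * (int q ^ e * (- 1))] (mod int n)"
      by (intro cong_mult q_power_m cong_refl)
    then have "[- (i * int q ^ e) = j] (mod int n)"
      using cong by (simp add: e power_add mult_ac cong_def)
    then have "[- (- (i * int q ^ e)) = - j] (mod int n)"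
      unfolding cong_minus_minus_iff .
    then show ?thesis using that[of "-1" e] e d by simp
  qed
  show ?thesis
  proof (cases "e \<le> t")
    case True
    have "int n dvd i * int q ^ e - \<kappa> * j" using ce by (simp add: cong_iff_dvd_diff)
    then show ?thesis
      using small_representatives[of i j e \<kappa>] repsD[OF i] repsD[OF j] True \<kappa> e by auto
  next
    case False
    \<comment> \<open>Multiplying by \<open>q ^ f\<close> completes the exponent to \<open>m\<close>
      and moves the power of \<open>q\<close> to \<open>j\<close>; as \<open>m = 2 * t + 1\<close>,
      the new exponent is at most \<open>t\<close>. It is positive, so this case ends in a
      contradiction.\<close>
    define f where "f = m - e"
    have f: "1 \<le> f" "f \<le> t" "e + f = m" using False e by (auto simp: f_def m_def)
    have "[i * int q ^ e * int q ^ f = \<kappa> * j * int q ^ f] (mod int n)"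
      by (intro cong_mult[OF ce] cong_refl)
    moreover have "i * int q ^ e * int q ^ f = i * int q ^ m"
      using f by (simp add: power_add[symmetric])
    moreover have "[i * int q ^ m = i * (- 1)] (mod int n)"
      by (intro cong_mult q_power_m cong_refl)
    ultimately have "[\<kappa> * j * int q ^ f = - i] (mod int n)"
      by (simp add: cong_def)
    then have "[\<kappa> * (\<kappa> * j * int q ^ f) = \<kappa> * (- i)] (mod int n)"
      by (intro cong_mult cong_refl)
    then have "int n dvd j * int q ^ f - (- \<kappa>) * i"
      using \<kappa> by (auto simp: cong_iff_dvd_diff)
    then show ?thesis
      using small_representatives[of j i f "- \<kappa>"] repsD[OF i] repsD[OF j] f \<kappa> by auto
  qed
qed

text \<open>For \<open>i = j\<close> this says that each coset has full size \<open>2 * m\<close>,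
  for different representatives that cosets are disjoint. Cancelling the smaller power of
  \<open>q\<close> reduces it to \<open>reps_power_cong\<close>.\<close>

lemma reps_cong_unique:
  assumes i: "i \<in> reps" and j: "j \<in> reps" and d: "d < 2 * m" "e < 2 * m"
    and cong: "[i * int q ^ d = j * int q ^ e] (mod int n)"
  shows "i = j \<and> d = e"
proof -
  have *: "i' = j' \<and> d' = e'" if i': "i' \<in> reps" and j': "j' \<in> reps" and d': "d' < 2 * m" and le: "e' \<le> d'"
    and c: "[i' * int q ^ d' = j' * int q ^ e'] (mod int n)" for i' j' d' e'
  proof -
    have "i' * int q ^ d' = i' * int q ^ (d' - e') * int q ^ e'"
      using le by (simp add: mult.assoc power_add[symmetric])
    then have "[i' * int q ^ (d' - e') = j'] (mod int n)"
      using c cong_cancel_q_power by metis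
    then have "i' = j' \<and> d' - e' = 0"
      using i' j' d' by (intro reps_power_cong) auto
    then show ?thesis using le by simp
  qed
  show ?thesis
    using *[of i j d e] *[of j i e d] assms cong_sym by (cases "e \<le> d") auto
qed

lemma in_orbit_cong: "[x = y] (mod int n) \<Longrightarrow> in_orbit x \<longleftrightarrow> in_orbit y"
  by (simp add: in_orbit_def cong_def)

lemma in_orbit_mult_power:
  assumes "in_orbit x"
  shows "in_orbit (x * int q ^ s)"
proof -
  obtain i e where i: "i \<in> reps" "[x = i * int q ^ e] (mod int n)"
    using assms by (auto simp: in_orbit_def)
  then have "[x * int q ^ s = i * int q ^ e * int q ^ s] (mod int n)"
    by (intro cong_mult cong_refl)
  then show ?thesis
    using i(1) unfolding in_orbit_def by (auto simp: mult.assoc power_add[symmetric])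
qed

lemma in_orbit_uminus:
  assumes "in_orbit x"
  shows "in_orbit (- x)"
proof -
  have "[x * int q ^ m = x * (- 1)] (mod int n)"
    by (intro cong_mult q_power_m cong_refl)
  then show ?thesis
    using in_orbit_mult_power[OF assms, of m] in_orbit_cong by simp
qed

lemma q_power_2m_mult: "[int q ^ (2 * m * s) = 1] (mod int n)"
  using cong_pow[OF q_power_2m, of s] by (simp add: power_mult)

text \<open>Multiplication by \<open>q ^ ((2 * m - 1) * s)\<close> undoes multiplication by
  \<open>q ^ s\<close> modulo \<open>n\<close>.\<close>

lemma in_orbit_mult_powerD:
  assumes "in_orbit (x * int q ^ s)"
  shows "in_orbit x"
proof -
  have "2 * m * s = s + (2 * m - 1) * s"
    by (simp add: m_def algebra_simps)
  then have "x * int q ^ s * int q ^ ((2 * m - 1) * s) = x * int q ^ (2 * m * s)"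
    by (simp only: mult.assoc power_add)
  moreover have "[x * int q ^ (2 * m * s) = x * 1] (mod int n)"
    by (intro cong_mult q_power_2m_mult cong_refl)
  ultimately show ?thesis
    using in_orbit_mult_power[OF assms, of "(2 * m - 1) * s"] in_orbit_cong
    by (metis mult.right_neutral)
qed

lemma reps_in_orbit: "i \<in> reps \<Longrightarrow> in_orbit i"
  unfolding in_orbit_def by (intro bexI[of _ i] exI[of _ 0]) auto

text \<open>Strong induction: a multiple of \<open>q\<close> passes to its quotient. The removed
  numbers return through their partners, because \<open>a * Q\<close> is
  \<open>- \<sigma> * r\<close> and \<open>(a - \<sigma>) * Q\<close> is
  \<open>- \<sigma> * (Q + r)\<close> modulo \<open>n\<close>.\<close>

lemma in_orbit_small:
  assumes "1 \<le> i" "i \<le> int \<delta> - 1"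
  shows "in_orbit i"
  using assms
proof (induction "nat i" arbitrary: i rule: less_induct)
  case less
  have r: "r \<in> reps"
    using r_bounds a_bounds not_q_dvd \<delta>_ge Q_ge by (auto simp: reps_def)
  \<comment> \<open>The lower bound on \<delta> enters here: \<open>a - \<sigma>\<close> is at most
    \<open>Q\<close> and hence below \<delta>.\<close>
  have a': "a - \<sigma> \<in> reps"
    using r_bounds a_bounds not_q_dvd \<delta>_ge Q_ge \<sigma> by (auto simp: reps_def)
  consider "int q dvd i" | "i \<in> reps" | "i = a" | "i = Q + r"
    using less.prems by (auto simp: reps_def)
  then show ?case
  proof cases
    case 1
    then obtain k where k: "i = int q * k" by auto
    have "k \<ge> 1" using k less.prems by (auto simp: int_one_le_iff_zero_less zero_less_mult_iff)
    moreover have "k < i" using k q_ge \<open>k \<ge> 1\<close> by simp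
    ultimately have "in_orbit k" using less by auto
    then show ?thesis using in_orbit_mult_power[of k 1] k by (simp add: mult.commute)
  next
    case 2
    then show ?thesis by (rule reps_in_orbit)
  next
    case 3
    have "[a * int q ^ t = - \<sigma> * r] (mod int n)"
      unfolding cong_iff_dvd_diff n_eq Q_def[symmetric] by (simp add: mult.commute)
    moreover have "in_orbit (- \<sigma> * r)"
      using reps_in_orbit[OF r] in_orbit_uminus[of r] \<sigma> by auto
    ultimately show ?thesis using in_orbit_cong in_orbit_mult_powerD 3 by blast
  next
    case 4
    have "(a - \<sigma>) * Q - (- \<sigma> * (Q + r)) = int n"
      unfolding n_eq by (simp add: algebra_simps)
    then have "[(a - \<sigma>) * int q ^ t = - \<sigma> * (Q + r)] (mod int n)"
      unfolding cong_iff_dvd_diff Q_def[symmetric] by simp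
    then have "in_orbit (- \<sigma> * (Q + r))"
      using in_orbit_mult_power[OF reps_in_orbit[OF a'], of t] in_orbit_cong by blast
    then show ?thesis using \<sigma> 4 in_orbit_uminus[of "- (Q + r)"] by (metis minus_minus mult_1 mult_minus1)
  qed
qed

lemma n_pos: "n > 0"
  using n_gt a_bounds Q_ge by linarith

lemma \<delta>_less_n: "\<delta> < n"
  using n_gt \<delta>_le by linarith

lemma not_in_orbit_0: "\<not> in_orbit 0"
proof
  assume "in_orbit 0"
  then obtain i s where i: "i \<in> reps" "[0 = i * int q ^ s] (mod int n)"
    by (auto simp: in_orbit_def)
  then have "[0 * int q ^ s = i * int q ^ s] (mod int n)" by simp
  then have "[0 = i] (mod int n)" by (simp only: cong_cancel_q_power)
  then have "int n dvd i" by (metis cong_0_iff cong_sym)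
  then show False
    using repsD[OF i(1)] n_gt zdvd_imp_le[of "int n" i] by linarith
qed

lemma defining_set_mod: "x mod n \<in> defining_set \<longleftrightarrow> in_orbit (int x)"
  using n_pos in_orbit_cong[of "int (x mod n)" "int x"]
  by (auto simp: defining_set_def zmod_int)

lemma card_defining_set: "card defining_set = 2 * m * card reps"
proof -
  let ?f = "\<lambda>(i, s). nat (i * int q ^ s mod int n)"
  have nn: "0 < int n" using n_pos by simp
  have int: "int (nat (x mod int n)) = x mod int n" for x
    using nn by simp
  have inj: "inj_on ?f (reps \<times> {..<2 * m})"
  proof (rule inj_onI, clarsimp)
    fix i s j e
    assume ij: "i \<in> reps" "j \<in> reps" "s < 2 * m" "e < 2 * m"
      and eq: "nat (i * int q ^ s mod int n) = nat (j * int q ^ e mod int n)"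
    from eq have "[i * int q ^ s = j * int q ^ e] (mod int n)"
      unfolding cong_def by (metis int)
    then show "i = j \<and> s = e" using ij reps_cong_unique by blast
  qed
  have "?f ` (reps \<times> {..<2 * m}) = defining_set"
  proof (intro equalityI subsetI)
    fix x assume "x \<in> ?f ` (reps \<times> {..<2 * m})"
    then obtain i s where i: "i \<in> reps" "x = nat (i * int q ^ s mod int n)" by auto
    have "int x = i * int q ^ s mod int n" using i nn by simp
    moreover from this have "int x < int n" using nn by simp
    ultimately show "x \<in> defining_set"
      unfolding defining_set_def in_orbit_def using i(1)
      by (auto intro!: bexI[of _ i] exI[of _ s] simp: cong_def)
  next
    fix x assume x: "x \<in> defining_set"
    then obtain i s where i: "i \<in> reps" "[int x = i * int q ^ s] (mod int n)"
      by (auto simp: defining_set_def in_orbit_def)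
    define e where "e = s mod (2 * m)"
    have "s = 2 * m * (s div (2 * m)) + e" by (simp add: e_def)
    then have "i * int q ^ s = i * (int q ^ (2 * m * (s div (2 * m))) * int q ^ e)"
      by (metis power_add)
    moreover have "[i * (int q ^ (2 * m * (s div (2 * m))) * int q ^ e) = i * (1 * int q ^ e)] (mod int n)"
      by (intro cong_mult q_power_2m_mult cong_refl)
    ultimately have "[int x = i * int q ^ e] (mod int n)"
      using i(2) cong_trans by auto
    then have "int x = i * int q ^ e mod int n"
      using x by (simp add: cong_def defining_set_def)
    then have "x = ?f (i, e)" by (metis case_prod_conv nat_int)
    moreover have "e < 2 * m" by (simp add: e_def m_def)
    ultimately show "x \<in> ?f ` (reps \<times> {..<2 * m})" using i(1) by blast
  qed
  then have "card defining_set = card (reps \<times> {..<2 * m})"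
    using card_image[OF inj] by simp
  then show ?thesis by (simp add: card_cartesian_product)
qed

text \<open>The number \<open>a\<close> always lies below \<delta>, while \<open>Q + r\<close>,
  which is \<open>A\<close>, does so only for \<open>\<delta> > A\<close>. This is the change from
  \<open>\<epsilon> - 1\<close> to \<open>\<epsilon> - 2\<close>.\<close>

lemma card_reps:
  "int (card reps) = \<lceil>(real \<delta> - 1) * (1 - 1 / real q)\<rceil> - (if int \<delta> \<le> Q + r then 1 else 2)"
proof -
  let ?N = "{i\<in>{1..int \<delta> - 1}. \<not> int q dvd i}"
  have c: "int (card ?N) = \<lceil>(real \<delta> - 1) * (1 - 1 / real q)\<rceil>"
    using card_not_dvd_atLeastAtMost[of "int q" "int \<delta> - 1"]
      ceiling_mult_one_minus_inverse[of "int q" "int \<delta> - 1"] q_ge \<delta>_ge Q_ge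
    by simp
  have fin: "finite ?N" by (rule finite_Collect_conjI) simp
  have aN: "a \<in> ?N" using a_bounds \<delta>_ge Q_ge not_q_dvd by auto
  have ne: "a \<noteq> Q + r" using a_bounds r_bounds by auto
  show ?thesis
  proof (cases "int \<delta> \<le> Q + r")
    case True
    then have "reps = ?N - {a}" by (auto simp: reps_def)
    then have "int (card reps) = int (card ?N) - 1"
      using card_Suc_Diff1[OF fin aN] by simp
    then show ?thesis using c True by simp
  next
    case False
    then have "Q + r \<in> ?N" using not_q_dvd r_bounds Q_ge by auto
    then have sub: "{a, Q + r} \<subseteq> ?N" using aN by simp
    have "card {a, Q + r} = 2" using ne by simp
    moreover have "card reps = card ?N - card {a, Q + r}"
      unfolding reps_def using sub by (intro card_Diff_subset) auto
    moreover have "card {a, Q + r} \<le> card ?N" using sub by (intro card_mono fin)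
    ultimately show ?thesis using c False by simp
  qed
qed

end

section \<open>Parameters of the BCH codes\<close>

text \<open>The powers of \<alpha> with exponent below \<open>M\<close> already exhaust the
  \<open>M\<close> nonzero elements, so they are distinct; this passes to the powers of
  \<beta>.\<close>

lemma root_of_unity_from_generator:
  fixes \<alpha> :: "'b::{finite,field}"
  assumes gen: "\<And>y. y \<noteq> 0 \<Longrightarrow> \<exists>j::nat. y = \<alpha> ^ j"
    and card: "card (UNIV :: 'b set) > 2" and dvd: "n dvd card (UNIV :: 'b set) - 1"
  defines "\<beta> \<equiv> \<alpha> ^ ((card (UNIV :: 'b set) - 1) div n)"
  shows "\<beta> ^ n = 1" "inj_on (\<lambda>i. \<beta> ^ i) {..<n}"
proof -
  define M where "M = card (UNIV :: 'b set) - 1"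
  have M: "M > 1" using card by (simp add: M_def)
  \<comment> \<open>Powers of zero give only \<open>0\<close> and \<open>1\<close>, too few for a
    field of more than two elements.\<close>
  have \<alpha>0: "\<alpha> \<noteq> 0"
  proof
    assume "\<alpha> = 0"
    then have "UNIV \<subseteq> {0, 1 :: 'b}" using gen by (metis insertCI power_0_left subsetI)
    then have "card (UNIV :: 'b set) \<le> card {0, 1 :: 'b}" by (intro card_mono) auto
    then show False using card by simp
  qed
  have \<alpha>M: "\<alpha> ^ M = 1"
  proof -
    have "\<alpha> * \<alpha> ^ M = \<alpha> * 1"
      using finite_field_power_card[of \<alpha>] card by (simp add: M_def flip: power_Suc)
    then show ?thesis using \<alpha>0 by simp
  qed
  have "(\<lambda>i. \<alpha> ^ i) ` {..<M} = UNIV - {0}"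
  proof (intro equalityI subsetI)
    fix y assume "y \<in> UNIV - {0 :: 'b}"
    then obtain j where j: "y = \<alpha> ^ j" using gen by auto
    have "\<alpha> ^ j = \<alpha> ^ (M * (j div M) + j mod M)" by simp
    also have "\<dots> = \<alpha> ^ (j mod M)" by (simp only: power_add power_mult \<alpha>M) simp
    finally show "y \<in> (\<lambda>i. \<alpha> ^ i) ` {..<M}" using j M by auto
  qed (use \<alpha>0 in auto)
  then have inj: "inj_on (\<lambda>i. \<alpha> ^ i) {..<M}"
    by (intro eq_card_imp_inj_on) (auto simp: M_def card_Diff_singleton)
  obtain k where k: "M = n * k" using dvd by (auto simp: M_def)
  have pos: "k > 0" "n > 0" using k M by (auto intro: Nat.gr0I)
  have \<beta>: "\<beta> = \<alpha> ^ k" using k pos unfolding \<beta>_def M_def[symmetric] by simp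
  show "\<beta> ^ n = 1" using \<alpha>M k by (simp add: \<beta> mult.commute flip: power_mult)
  show "inj_on (\<lambda>i. \<beta> ^ i) {..<n}"
  proof (rule inj_onI)
    fix i j assume ij: "i \<in> {..<n}" "j \<in> {..<n}" and "\<beta> ^ i = \<beta> ^ j"
    then have "\<alpha> ^ (k * i) = \<alpha> ^ (k * j)" by (simp add: \<beta> power_mult)
    moreover have "k * i < M" "k * j < M" using ij pos by (auto simp: k)
    ultimately have "k * i = k * j" using inj by (auto dest: inj_onD)
    then show "i = j" using pos by simp
  qed
qed

text \<open>Turns the closed forms, with their parity cases and divisions of natural numbers, into
  exact integer identities with one sign \<sigma>. As \<open>q\<close> is \<open>- 1\<close> modulo
  \<open>q + 1\<close>, the number \<open>Q + \<sigma>\<close> is divisible by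
  \<open>q + 1\<close>.\<close>

lemma bch_params_exist:
  fixes q m t n \<delta> A B :: nat
  assumes q_ge: "q \<ge> 5" and m_def: "m = 2 * t + 1" and m_ge: "m \<ge> 5"
    and n_def: "n = (q ^ m + 1) div (q + 1)"
    and A_def: "A = (if odd t then (q ^ (t + 1) + 2 * q ^ t + 1) div (q + 1)
                     else (q ^ (t + 1) + 2 * q ^ t - 1) div (q + 1))"
    and B_def: "B = (if odd t then 2 * ((q ^ (t + 1) - 1) div (q + 1)) - 1
                     else 2 * ((q ^ (t + 1) + 1) div (q + 1)) - 1)"
    and \<delta>: "q ^ t + 2 \<le> \<delta>" "\<delta> \<le> B"
  shows "\<exists>Q a r \<sigma>. bch_params q t n \<delta> Q a r \<sigma> \<and> int A = Q + r"
proof -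
  define \<sigma> :: int where "\<sigma> = (if odd t then 1 else -1)"
  define Q where "Q = int q ^ t"
  have "[int q ^ t = (- 1) ^ t] (mod (int q + 1))"
    by (intro cong_pow) (simp add: cong_iff_dvd_diff)
  then have "int q + 1 dvd Q + \<sigma>"
    by (auto simp: cong_iff_dvd_diff Q_def \<sigma>_def)
  then obtain r where r: "(int q + 1) * r = Q + \<sigma>" by (metis dvd_def)
  define a where "a = Q - r"
  have nz: "int q + 1 \<noteq> 0" by simp
  have a: "(int q + 1) * a = int q * Q - \<sigma>"
    using r by (simp add: a_def algebra_simps)
  have "(int q + 1) * (Q * a + \<sigma> * r) = Q * ((int q + 1) * a) + \<sigma> * ((int q + 1) * r)"
    by (simp add: algebra_simps)
  also have "\<dots> = int q * (Q * Q) + \<sigma> * \<sigma>"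
    unfolding a r by (simp add: algebra_simps)
  also have "\<dots> = int q ^ m + 1"
    by (simp add: Q_def m_def \<sigma>_def power_add mult_2)
  finally have n: "int n = Q * a + \<sigma> * r"
    unfolding n_def zdiv_int using nonzero_mult_div_cancel_left[OF nz, of "Q * a + \<sigma> * r"]
    by (simp add: add.commute)
  have A: "int A = Q + r"
  proof -
    \<comment> \<open>Guards the truncated subtraction in the even case of \<open>A\<close>.\<close>
    have le: "Suc 0 \<le> q * q ^ t + 2 * q ^ t" using q_ge by (simp add: Suc_le_eq)
    have "int A = (int q * Q + 2 * Q + \<sigma>) div (int q + 1)"
      using le by (auto simp: A_def \<sigma>_def Q_def zdiv_int of_nat_diff add.commute)
    also have "int q * Q + 2 * Q + \<sigma> = (int q + 1) * (Q + r)"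
      using r by (simp add: algebra_simps)
    finally show ?thesis using nonzero_mult_div_cancel_left[OF nz] by simp
  qed
  have B: "\<delta> \<le> 2 * a - 1"
  proof -
    define a' where "a' = (if odd t then (q ^ (t + 1) - 1) div (q + 1) else (q ^ (t + 1) + 1) div (q + 1))"
    have "int a' = (int q * Q - \<sigma>) div (int q + 1)"
      using q_ge by (auto simp: a'_def \<sigma>_def Q_def zdiv_int of_nat_diff add.commute)
    then have "int a' = a" unfolding a[symmetric] using nonzero_mult_div_cancel_left[OF nz] by simp
    moreover have "B = 2 * a' - 1" by (simp add: B_def a'_def)
    ultimately show ?thesis using \<delta> by linarith
  qed
  have "bch_params q t n \<delta> Q a r \<sigma>"
    using q_ge m_def m_ge r n B \<delta>
    by unfold_locales (auto simp: Q_def a_def \<sigma>_def simp flip: of_nat_power)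
  then show ?thesis using A by blast
qed

theorem theorem7:
  fixes emb :: "'a::{finite,field} \<Rightarrow> 'b::{finite,field}"
    and \<alpha> :: 'b and q m t n \<delta> :: nat and A B :: nat and \<epsilon> k :: int
  assumes q_def: "q = card (UNIV :: 'a set)" and q_odd: "odd q" and q_ge: "q \<ge> 5"
    and m_def: "m = 2 * t + 1" and m_ge: "m \<ge> 5"
    and n_def: "n = (q ^ m + 1) div (q + 1)"
    and card_b: "card (UNIV :: 'b set) = q ^ ord n q"
    and emb_add: "\<And>x y. emb (x + y) = emb x + emb y"
    and emb_mult: "\<And>x y. emb (x * y) = emb x * emb y"
    and emb_one: "emb 1 = 1"
    and \<alpha>_gen: "\<And>y. y \<noteq> 0 \<Longrightarrow> \<exists>j::nat. y = \<alpha> ^ j"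
    and \<epsilon>_def: "\<epsilon> = \<lceil>(real \<delta> - 1) * (1 - 1 / real q)\<rceil>"
    and A_def: "A = (if odd t then (q ^ (t + 1) + 2 * q ^ t + 1) div (q + 1)
                     else (q ^ (t + 1) + 2 * q ^ t - 1) div (q + 1))"
    and B_def: "B = (if odd t then 2 * ((q ^ (t + 1) - 1) div (q + 1)) - 1
                     else 2 * ((q ^ (t + 1) + 1) div (q + 1)) - 1)"
    and k_def: "k = (if \<delta> \<le> A then int n - 2 * int m * (\<epsilon> - 1)
                     else int n - 2 * int m * (\<epsilon> - 2))"
    and \<delta>_range: "q ^ t + 2 \<le> \<delta>" "\<delta> \<le> B"
  shows "let \<beta> = \<alpha> ^ ((q ^ ord n q - 1) div n);
             C1 = bch_code n emb \<beta> \<delta> 1;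
             C0 = bch_code n emb \<beta> (\<delta> + 1) 0
         in is_LCD n C1
            \<and> card C1 = q ^ nat k
            \<and> (\<forall>c\<in>C1. c \<noteq> 0 \<longrightarrow> hamming_weight c \<ge> \<delta>)
            \<and> card C0 = q ^ nat (k - 1)
            \<and> (\<forall>c\<in>C0. c \<noteq> 0 \<longrightarrow> hamming_weight c \<ge> 2 * \<delta>)"
proof -
  interpret E: finite_field_embedding emb q
    using q_def emb_add emb_mult emb_one by unfold_locales auto
  obtain Q a r \<sigma> where par: "bch_params q t n \<delta> Q a r \<sigma>" and A: "int A = Q + r"
    using bch_params_exist[OF q_ge m_def m_ge n_def A_def B_def \<delta>_range] by blast
  interpret P: bch_params q t n \<delta> Q a r \<sigma> by (rule par)
  have n0: "n > 0" by (rule P.n_pos)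
  have \<delta>n: "\<delta> < n" and \<delta>2: "\<delta> \<ge> 2" using P.\<delta>_less_n \<delta>_range by auto
  define \<beta> where "\<beta> = \<alpha> ^ ((q ^ ord n q - 1) div n)"
  have "ord n q > 0" using P.coprime_q_n ord_eq_0[of n q] by (auto simp: coprime_commute)
  then have "q ^ 1 \<le> q ^ ord n q" using q_ge by (intro power_increasing) linarith+
  then have card2: "card (UNIV :: 'b set) > 2" using q_ge card_b by simp
  \<comment> \<open>By the choice of \<open>ord n q\<close>, the power \<open>q ^ ord n q\<close> is
    \<open>1\<close> modulo \<open>n\<close>.\<close>
  have "n dvd card (UNIV :: 'b set) - 1"
    unfolding card_b using ord[of q n] card2 card_b
    by (metis cong_to_1_nat)
  note root = root_of_unity_from_generator[OF \<alpha>_gen card2 this]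
  have \<beta>n: "\<beta> ^ n = 1" and inj: "inj_on (\<lambda>i. \<beta> ^ i) {..<n}"
    using root by (simp_all add: \<beta>_def card_b)
  have \<beta>0: "\<beta> \<noteq> 0" using \<beta>n n0 by (auto simp: zero_power)
  have \<beta>mod: "\<beta> ^ (x mod n) = \<beta> ^ x" for x
  proof -
    have "\<beta> ^ x = \<beta> ^ (n * (x div n) + x mod n)" by simp
    also have "\<dots> = \<beta> ^ (x mod n)" by (simp only: power_add power_mult \<beta>n) simp
    finally show ?thesis by simp
  qed
  define R where "R = (\<lambda>i. \<beta> ^ i) ` P.defining_set"
  have R_sub: "R \<subseteq> (\<lambda>i. \<beta> ^ i) ` {..<n}"
    unfolding R_def by (intro image_mono) (auto simp: P.defining_set_def)
  have R_I: "\<beta> ^ x \<in> R" if "P.in_orbit (int x)" for x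
    using that \<beta>mod[of x] P.defining_set_mod[of x] by (auto simp: R_def intro!: image_eqI[of _ _ "x mod n"])
  have R_E: "\<exists>x. y = \<beta> ^ x \<and> x < n \<and> 0 < x \<and> P.in_orbit (int x)" if "y \<in> R" for y
    using that P.not_in_orbit_0 by (auto simp: R_def P.defining_set_def intro!: Nat.gr0I)
  have one: "1 \<notin> R"
  proof
    assume "1 \<in> R"
    then obtain x where "\<beta> ^ x = \<beta> ^ 0" "x < n" "0 < x" using R_E by force
    then show False using inj_onD[OF inj, of x 0] n0 by simp
  qed
  have closed: "E.frob_closed R"
    unfolding E.frob_closed_def
  proof
    fix y assume "y \<in> R"
    then obtain x where x: "y = \<beta> ^ x" "P.in_orbit (int x)" using R_E by blast
    then show "y ^ q \<in> R"
      using R_I[of "x * q"] P.in_orbit_mult_power[of "int x" 1] by (simp add: power_mult)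
  qed
  then have closed0: "E.frob_closed (insert 1 R)"
    by (auto simp: E.frob_closed_def)
  have neg: "inverse y \<in> R" if y: "y \<in> R" for y
  proof -
    obtain x where x: "y = \<beta> ^ x" "x < n" "P.in_orbit (int x)" using R_E[OF y] by blast
    have "P.in_orbit (int (n - x))"
      using x P.in_orbit_uminus[of "int x"] P.in_orbit_cong[of "int (n - x)" "- int x"]
      by (simp add: of_nat_diff cong_iff_dvd_diff)
    moreover have "inverse y = \<beta> ^ (n - x)"
      using x \<beta>n by (intro inverse_unique) (simp add: power_add[symmetric])
    ultimately show ?thesis using R_I by simp
  qed
  have small: "\<beta> ^ i \<in> R" if "1 \<le> i" "i \<le> \<delta> - 1" for i
    using that \<delta>2 by (intro R_I P.in_orbit_small) auto
  have gen: "\<exists>i\<in>{1..\<delta> - 1}. \<exists>s. y = (\<beta> ^ i) ^ (q ^ s)" if y: "y \<in> R" for y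
  proof -
    obtain x where x: "y = \<beta> ^ x" "P.in_orbit (int x)" using R_E[OF y] by blast
    then obtain i s where i: "i \<in> P.reps" "[int x = i * int q ^ s] (mod int n)"
      by (auto simp: P.in_orbit_def)
    have b: "1 \<le> i" "i \<le> int \<delta> - 1" using P.repsD[OF i(1)] by auto
    then have "[int x = int (nat i * q ^ s)] (mod int n)" using i(2) by simp
    then have "[x = nat i * q ^ s] (mod n)" by (simp only: cong_int_iff)
    then have "\<beta> ^ x = \<beta> ^ (nat i * q ^ s)" by (metis \<beta>mod cong_def)
    then show ?thesis
      using x b by (intro bexI[of _ "nat i"] exI[of _ s]) (auto simp: power_mult)
  qed
  have C1: "bch_code n emb \<beta> \<delta> 1 = E.root_code n R"
    using \<delta>2 small gen by (intro E.bch_code_eq_root_code closed) auto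
  \<comment> \<open>Designed distance \<open>\<delta> + 1\<close> from offset \<open>0\<close> gives
    the exponents \<open>0\<close> to \<open>\<delta> - 1\<close>, so only the zero \<open>1\<close>
    is added.\<close>
  have C0: "bch_code n emb \<beta> (\<delta> + 1) 0 = E.root_code n (insert 1 R)"
  proof (intro E.bch_code_eq_root_code closed0)
    fix i assume "i \<in> {0..0 + (\<delta> + 1) - 2}"
    then show "\<beta> ^ i \<in> insert 1 R" using small[of i] by (cases "i = 0") auto
  next
    fix y assume "y \<in> insert 1 R"
    then show "\<exists>i\<in>{0..0 + (\<delta> + 1) - 2}. \<exists>s. y = (\<beta> ^ i) ^ (q ^ s)"
      using gen[of y] by (force intro: bexI[of _ 0])
  qed
  have cardR: "card R = 2 * m * card P.reps"
    unfolding R_def using P.card_defining_set inj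
    by (subst card_image) (auto simp: P.m_def m_def P.defining_set_def intro: inj_on_subset)
  have "card (insert 1 R) \<le> card ((\<lambda>i. \<beta> ^ i) ` {..<n})"
    using R_sub n0 by (intro card_mono) (auto intro!: image_eqI[of _ _ 0])
  then have Rn: "card R + 1 \<le> n"
    using one inj by (simp add: card_image R_def)
  have k: "k = int n - int (card R)"
  proof -
    have "\<delta> \<le> A \<longleftrightarrow> int \<delta> \<le> Q + r" using A by linarith
    then show ?thesis
      using P.card_reps cardR by (simp add: k_def \<epsilon>_def)
  qed
  have "is_LCD n (E.root_code n R)"
    by (rule E.root_code_LCD[OF n0 \<beta>n inj closed R_sub one neg])
  moreover have "card (E.root_code n R) = q ^ nat k"
    using E.card_root_code[OF closed _ n0] Rn k by (simp add: nat_diff_distrib)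
  moreover have "card (E.root_code n (insert 1 R)) = q ^ nat (k - 1)"
  proof -
    have "nat (k - 1) = n - (card R + 1)" using k Rn by linarith
    then show ?thesis using E.card_root_code[OF closed0 _ n0] Rn one by (simp add: R_def)
  qed
  moreover have "hamming_weight c \<ge> \<delta>" if "c \<in> E.root_code n R" "c \<noteq> 0" for c
  proof -
    have "E.ev c (\<beta> ^ (1 + i)) = 0" if "i < \<delta> - 1" for i
      using \<open>c \<in> E.root_code n R\<close> that small[of "1 + i"] by (simp add: E.root_code_def)
    then have "hamming_weight c > \<delta> - 1"
      using that by (intro E.bch_bound[OF inj \<beta>0, where b = 1]) (auto simp: E.root_code_def)
    then show ?thesis by simp
  qed
  moreover have "hamming_weight c \<ge> 2 * \<delta>" if c: "c \<in> E.root_code n (insert 1 R)" "c \<noteq> 0" for c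
  proof -
    \<comment> \<open>Modulo \<open>n\<close> the exponents run from \<open>- (\<delta> - 1)\<close>
      to \<open>\<delta> - 1\<close>; the offset \<open>n - (\<delta> - 1)\<close> keeps them
      natural. Negative ones are zeros by \<open>neg\<close>, the middle one is the zero
      \<open>1\<close>.\<close>
    have roots: "\<beta> ^ (n - (\<delta> - 1) + i) \<in> insert 1 R" if i: "i < 2 * \<delta> - 1" for i
    proof -
      consider "i < \<delta> - 1" | "i = \<delta> - 1" | "i > \<delta> - 1" by linarith
      then show ?thesis
      proof cases
        case 1
        then have "\<beta> ^ (\<delta> - 1 - i) * \<beta> ^ (n - (\<delta> - 1) + i) = 1"
          using \<beta>n \<delta>n by (simp flip: power_add)
        then have "inverse (\<beta> ^ (\<delta> - 1 - i)) = \<beta> ^ (n - (\<delta> - 1) + i)" by (rule inverse_unique)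
        moreover have "\<beta> ^ (\<delta> - 1 - i) \<in> R" using 1 by (intro small) auto
        ultimately show ?thesis using neg by (metis insertI2)
      next
        case 2
        then show ?thesis using \<beta>n \<delta>n by simp
      next
        case 3
        then have "n - (\<delta> - 1) + i = n + (i - (\<delta> - 1))" using \<delta>n by linarith
        then have "\<beta> ^ (n - (\<delta> - 1) + i) = \<beta> ^ (i - (\<delta> - 1))" by (simp add: power_add \<beta>n)
        moreover have "\<beta> ^ (i - (\<delta> - 1)) \<in> R" using 3 i by (intro small) auto
        ultimately show ?thesis by simp
      qed
    qed
    have "hamming_weight c > 2 * \<delta> - 1"
    proof (rule E.bch_bound[OF inj \<beta>0])
      show "E.ev c (\<beta> ^ (n - (\<delta> - 1) + i)) = 0" if "i < 2 * \<delta> - 1" for i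
        using c(1) roots[OF that] unfolding E.root_code_def by blast
    qed (use c in \<open>auto simp: E.root_code_def\<close>)
    then show ?thesis by simp
  qed
  ultimately show ?thesis
    unfolding Let_def \<beta>_def[symmetric] C1 C0 by blast
qed

end
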